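(* Let $\beta>0$ and $\eta>0$ be fixed and fix $s<-\frac{1}{2}$. Then there does not exist a $T>0$ such that the Cauchy problem $$u_t+uu_x+\beta \mathcal{H}u_{xx}+\eta(\mathcal{H}u_x-u_{xx})=0,\quad x\in\mathbb{R},\ t>0,\qquad u(x,0)=\phi(x),$$ admits a unique local solution defined on the interval $[0,T]$ and such that the flow map data-solution $\phi\mapsto u(t)$, $t\in[0,T]$, is $C^3$ differentiable at zero from $H^s(\mathbb{R})$ to $C([0,T];H^s(\mathbb{R}))$.
   Context: $\mathcal{H}$ denotes the Hilbert transform, $\mathcal{H}f=(i\,\mathrm{sgn}(\xi)\widehat{f}(\xi))^{\vee}$. Solutions are understood via the integral formulation $u(t)=S(t)\phi-\int_0^t S(t-t')[u(t')u_x(t')]\,dt'$, where $S(t)f=\big(e^{iq(\xi)t-p(\xi)t}\widehat f\big)^{\vee}$ for $t\ge0$, with $q(\xi)=\beta\xi|\xi|$ and $p(\xi)=\eta(\xi^2-|\xi|)$. $H^s(\mathbb{R})$ is the usual $L^2$-based Sobolev space. *)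

theory Defs
  imports "HOL-Analysis.Analysis"
begin

text \<open>Everything is formulated on the Fourier side, with the convention
  f^(xi) = integral of exp(-i x xi) f(x) dx, so that d/dx corresponds to multiplication
  by i xi and (f g)^ = (1/(2 pi)) (f^ * g^).  A function of x is represented by its
  Fourier transform g :: real => complex; a function of (t,x) by u :: real => real => complex
  with u t = Fourier transform of u(t,.).\<close>

definition Hs :: "real \<Rightarrow> (real \<Rightarrow> complex) set" where
  "Hs s = {g. g \<in> borel_measurable lborel
              \<and> integrable lborel (\<lambda>\<xi>. (1 + \<xi>\<^sup>2) powr s * (cmod (g \<xi>))\<^sup>2)
              \<and> (AE \<xi> in lborel. g (- \<xi>) = cnj (g \<xi>))}"

definition hs_norm :: "real \<Rightarrow> (real \<Rightarrow> complex) \<Rightarrow> real" where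
  "hs_norm s g = sqrt (LINT \<xi>|lborel. (1 + \<xi>\<^sup>2) powr s * (cmod (g \<xi>))\<^sup>2)"

definition CHs :: "real \<Rightarrow> real \<Rightarrow> (real \<Rightarrow> real \<Rightarrow> complex) set" where
  "CHs s T = {u. (\<forall>t\<in>{0..T}. u t \<in> Hs s)
              \<and> (\<forall>t\<in>{0..T}. ((\<lambda>t'. hs_norm s (\<lambda>\<xi>. u t' \<xi> - u t \<xi>)) \<longlongrightarrow> 0)
                                 (at t within {0..T}))}"

definition cnorm :: "real \<Rightarrow> real \<Rightarrow> (real \<Rightarrow> real \<Rightarrow> complex) \<Rightarrow> real" where
  "cnorm s T u = (SUP t\<in>{0..T}. hs_norm s (u t))"

text \<open>Fourier multiplier of the linear semigroup: exp((i q(xi) - p(xi)) tau),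
  q(xi) = beta xi |xi|, p(xi) = eta (xi^2 - |xi|).\<close>
definition phase :: "real \<Rightarrow> real \<Rightarrow> real \<Rightarrow> real \<Rightarrow> complex" where
  "phase \<beta> \<eta> \<tau> \<xi> = exp (Complex (- \<eta> * (\<xi>\<^sup>2 - \<bar>\<xi>\<bar>) * \<tau>) (\<beta> * \<xi> * \<bar>\<xi>\<bar> * \<tau>))"

text \<open>Fourier transform of u u_x = (1/2) (u^2)_x, i.e. (i xi / 2) (1/(2 pi)) (u^ * u^).\<close>
definition nonlin :: "(real \<Rightarrow> complex) \<Rightarrow> real \<Rightarrow> complex" where
  "nonlin v \<xi> = \<i> * complex_of_real (\<xi> / (4 * pi)) * (LINT \<zeta>|lborel. v (\<xi> - \<zeta>) * v \<zeta>)"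

definition mild_sol :: "real \<Rightarrow> real \<Rightarrow> real \<Rightarrow> (real \<Rightarrow> complex) \<Rightarrow> (real \<Rightarrow> real \<Rightarrow> complex) \<Rightarrow> bool" where
  "mild_sol \<beta> \<eta> T g u \<longleftrightarrow>
     (\<forall>t\<in>{0..T}. AE \<xi> in lborel.
        (\<forall>t'\<in>{0..t}. integrable lborel (\<lambda>\<zeta>. u t' (\<xi> - \<zeta>) * u t' \<zeta>))
      \<and> set_integrable lborel {0..t} (\<lambda>t'. phase \<beta> \<eta> (t - t') \<xi> * nonlin (u t') \<xi>)
      \<and> u t \<xi> = phase \<beta> \<eta> t \<xi> * g \<xi>
                 - set_lebesgue_integral lborel {0..t} (\<lambda>t'. phase \<beta> \<eta> (t - t') \<xi> * nonlin (u t') \<xi>))"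

definition addX :: "(real \<Rightarrow> complex) \<Rightarrow> (real \<Rightarrow> complex) \<Rightarrow> real \<Rightarrow> complex" where
  "addX g h = (\<lambda>\<xi>. g \<xi> + h \<xi>)"
definition scaleX :: "real \<Rightarrow> (real \<Rightarrow> complex) \<Rightarrow> real \<Rightarrow> complex" where
  "scaleX a g = (\<lambda>\<xi>. complex_of_real a * g \<xi>)"
definition subY :: "(real \<Rightarrow> real \<Rightarrow> complex) \<Rightarrow> (real \<Rightarrow> real \<Rightarrow> complex) \<Rightarrow> real \<Rightarrow> real \<Rightarrow> complex" where
  "subY u v = (\<lambda>t \<xi>. u t \<xi> - v t \<xi>)"
definition addY :: "(real \<Rightarrow> real \<Rightarrow> complex) \<Rightarrow> (real \<Rightarrow> real \<Rightarrow> complex) \<Rightarrow> real \<Rightarrow> real \<Rightarrow> complex" where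
  "addY u v = (\<lambda>t \<xi>. u t \<xi> + v t \<xi>)"
definition scaleY :: "real \<Rightarrow> (real \<Rightarrow> real \<Rightarrow> complex) \<Rightarrow> real \<Rightarrow> real \<Rightarrow> complex" where
  "scaleY a u = (\<lambda>t \<xi>. complex_of_real a * u t \<xi>)"

definition bl1 :: "real \<Rightarrow> real \<Rightarrow> ((real \<Rightarrow> complex) \<Rightarrow> (real \<Rightarrow> real \<Rightarrow> complex)) \<Rightarrow> bool" where
  "bl1 s T A \<longleftrightarrow>
     (\<forall>h\<in>Hs s. A h \<in> CHs s T)
   \<and> (\<forall>a h k. h \<in> Hs s \<and> k \<in> Hs s \<longrightarrow>
        cnorm s T (subY (A (addX (scaleX a h) k)) (addY (scaleY a (A h)) (A k))) = 0)
   \<and> (\<exists>C. \<forall>h\<in>Hs s. cnorm s T (A h) \<le> C * hs_norm s h)"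

definition bl2 :: "real \<Rightarrow> real \<Rightarrow> ((real \<Rightarrow> complex) \<Rightarrow> (real \<Rightarrow> complex) \<Rightarrow> (real \<Rightarrow> real \<Rightarrow> complex)) \<Rightarrow> bool" where
  "bl2 s T B \<longleftrightarrow>
     (\<forall>h\<in>Hs s. bl1 s T (B h)) \<and> (\<forall>k\<in>Hs s. bl1 s T (\<lambda>h. B h k))
   \<and> (\<exists>C. \<forall>h\<in>Hs s. \<forall>k\<in>Hs s. cnorm s T (B h k) \<le> C * hs_norm s h * hs_norm s k)"

definition bl3 :: "real \<Rightarrow> real \<Rightarrow> ((real \<Rightarrow> complex) \<Rightarrow> (real \<Rightarrow> complex) \<Rightarrow> (real \<Rightarrow> complex) \<Rightarrow> (real \<Rightarrow> real \<Rightarrow> complex)) \<Rightarrow> bool" where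
  "bl3 s T D \<longleftrightarrow>
     (\<forall>h\<in>Hs s. bl2 s T (D h)) \<and> (\<forall>k\<in>Hs s. \<forall>l\<in>Hs s. bl1 s T (\<lambda>h. D h k l))
   \<and> (\<exists>C. \<forall>h\<in>Hs s. \<forall>k\<in>Hs s. \<forall>l\<in>Hs s.
          cnorm s T (D h k l) \<le> C * hs_norm s h * hs_norm s k * hs_norm s l)"

definition C3_near_zero :: "real \<Rightarrow> real \<Rightarrow> ((real \<Rightarrow> complex) \<Rightarrow> (real \<Rightarrow> real \<Rightarrow> complex)) \<Rightarrow> bool" where
  "C3_near_zero s T \<Phi> \<longleftrightarrow> (\<exists>\<delta>>0. \<exists>D1 D2 D3.
     (\<forall>\<phi>\<in>Hs s. hs_norm s \<phi> < \<delta> \<longrightarrow>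
        bl1 s T (D1 \<phi>) \<and> bl2 s T (D2 \<phi>) \<and> bl3 s T (D3 \<phi>)
      \<and> (\<forall>\<epsilon>>0. \<exists>d>0. \<forall>h\<in>Hs s. hs_norm s h < d \<longrightarrow>
           cnorm s T (subY (subY (\<Phi> (addX \<phi> h)) (\<Phi> \<phi>)) (D1 \<phi> h)) \<le> \<epsilon> * hs_norm s h)
      \<and> (\<forall>\<epsilon>>0. \<exists>d>0. \<forall>h\<in>Hs s. hs_norm s h < d \<longrightarrow> (\<forall>k\<in>Hs s.
           cnorm s T (subY (subY (D1 (addX \<phi> h) k) (D1 \<phi> k)) (D2 \<phi> h k))
             \<le> \<epsilon> * hs_norm s h * hs_norm s k))
      \<and> (\<forall>\<epsilon>>0. \<exists>d>0. \<forall>h\<in>Hs s. hs_norm s h < d \<longrightarrow> (\<forall>k\<in>Hs s. \<forall>l\<in>Hs s.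
           cnorm s T (subY (subY (D2 (addX \<phi> h) k l) (D2 \<phi> k l)) (D3 \<phi> h k l))
             \<le> \<epsilon> * hs_norm s h * hs_norm s k * hs_norm s l))
      \<and> (\<forall>\<epsilon>>0. \<exists>d>0. \<forall>h\<in>Hs s. hs_norm s h < d \<longrightarrow> (\<forall>k\<in>Hs s. \<forall>l\<in>Hs s. \<forall>m\<in>Hs s.
           cnorm s T (subY (D3 (addX \<phi> h) k l m) (D3 \<phi> k l m))
             \<le> \<epsilon> * hs_norm s k * hs_norm s l * hs_norm s m))))"

definition wp_C3_flow :: "real \<Rightarrow> real \<Rightarrow> real \<Rightarrow> real \<Rightarrow> ((real \<Rightarrow> complex) \<Rightarrow> (real \<Rightarrow> real \<Rightarrow> complex)) \<Rightarrow> bool" where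
  "wp_C3_flow \<beta> \<eta> s T \<Phi> \<longleftrightarrow>
     (\<forall>\<phi>\<in>Hs s. \<Phi> \<phi> \<in> CHs s T)
   \<and> (\<forall>\<phi>\<in>Hs s \<inter> Hs 0.
        \<Phi> \<phi> \<in> CHs 0 T \<and> mild_sol \<beta> \<eta> T \<phi> (\<Phi> \<phi>)
      \<and> (\<forall>v. v \<in> CHs 0 T \<and> mild_sol \<beta> \<eta> T \<phi> v \<longrightarrow>
              (\<forall>t\<in>{0..T}. hs_norm 0 (\<lambda>\<xi>. v t \<xi> - \<Phi> \<phi> t \<xi>) = 0)))
   \<and> C3_near_zero s T \<Phi>"

end

theory Submission
  imports Defs
begin

text \<open>
  The exponent $-1/2$ is critical for the scaling $u \mapsto \lambda u(\lambda^2 t, \lambda x)$, which the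
  equation respects up to the lower-order term $\eta\mathcal{H}u_x$, so below it already the second
  derivative of the flow at zero fails to be bounded.  The data is the indicator function $h_N$ of
  $N \le |\xi| \le 2N$ on the Fourier side, observed at time $\tau/N^2$ in the frequency window
  $[5N/2, 3N]$.  There the linear evolution of $h_N$ vanishes, and the solution with data $\gamma h_N$ is
  $\gamma^2$ times a self-interaction whose Fourier phases are all close to $1$, up to
  $O(\gamma^3)$; the error is controlled by an $L^2$ bootstrap for the integral equation.
  Differentiability at zero bounds the $\gamma^2$ coefficient by $C \|h_N\|_{H^s}^2$.
  Comparing powers of $N$ gives $1 \lesssim N^{s+1/2}$, which is false for large $N$.
\<close>

text \<open>The second derivative of the flow is never computed. A lower bound for the flow itself
  is played against the upper bound that Taylor's formula extracts from differentiability. The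
  candidate derivatives are linear only up to zero \<open>cnorm\<close>, and functions matter only
  up to null sets. Everything is therefore read through a bounded real functional: along the ray a
  |-> a * h_N the flow becomes a real function of a real amplitude, ordinary calculus applies, and
  exceptional sets disappear. The integral equation is tied to the flow only for data that also lie
  in L^2, while differentiability is measured in H^s. The two meet because the bump lies in both
  spaces and because of the order of the limits: the amplitude \<gamma> becomes small with N fixed,
  and N grows afterwards. Hence the constants and thresholds of the L^2 estimates may depend on N in
  any way; they drop out once \<gamma>^2 is cancelled. Only the constant produced by
  differentiability has to be uniform in N.\<close>

section \<open>Two elementary facts about real numbers\<close>

text \<open>The choice c = \<beta> / \<alpha> optimises the hypothesis. Together with integrated
  pointwise bounds this does the work of the Cauchy-Schwarz inequality. In the degenerate cases one
  lets c be very large or very small.\<close>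

lemma le_two_mult_of_weighted:
  fixes X \<alpha> \<beta> :: real
  assumes "\<alpha> \<ge> 0" "\<beta> \<ge> 0" and le: "\<And>c. c > 0 \<Longrightarrow> X \<le> c * \<alpha>\<^sup>2 + \<beta>\<^sup>2 / c"
  shows "X \<le> 2 * \<alpha> * \<beta>"
proof (cases "\<alpha> = 0 \<or> \<beta> = 0")
  case False
  with assms have "\<alpha> > 0" "\<beta> > 0" by auto
  then show ?thesis using le[of "\<beta> / \<alpha>"] by (simp add: power2_eq_square)
next
  case True
  show ?thesis
  proof (rule ccontr)
    assume "\<not> ?thesis"
    with True have X: "X > 0" by auto
    show False
    proof (cases "\<alpha> = 0")
      case True
      \<comment> \<open>With \<alpha> = 0, a large c is wanted: this one turns the right-hand side
        into X times a factor below 1.\<close>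
      have "X \<le> \<beta>\<^sup>2 / ((\<beta>\<^sup>2 + 1) / X)"
        using le[of "(\<beta>\<^sup>2 + 1) / X"] X True by (simp add: add_nonneg_pos)
      moreover have "\<beta>\<^sup>2 + 1 > 0" by (simp add: add_nonneg_pos)
      ultimately have "X * (\<beta>\<^sup>2 + 1) \<le> \<beta>\<^sup>2 * X"
        using pos_le_divide_eq[of "\<beta>\<^sup>2 + 1" X "\<beta>\<^sup>2 * X"] by simp
      then show False using X by (simp add: algebra_simps)
    next
      case False
      with \<open>\<alpha> = 0 \<or> \<beta> = 0\<close> have "\<beta> = 0" by simp
      have "X \<le> X / (\<alpha>\<^sup>2 + 1) * \<alpha>\<^sup>2"
        using le[of "X / (\<alpha>\<^sup>2 + 1)"] X \<open>\<beta> = 0\<close> by (simp add: add_nonneg_pos)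
      moreover have "\<alpha>\<^sup>2 + 1 > 0" by (simp add: add_nonneg_pos)
      ultimately have "X * (\<alpha>\<^sup>2 + 1) \<le> X * \<alpha>\<^sup>2"
        using pos_le_divide_eq[of "\<alpha>\<^sup>2 + 1" X "X * \<alpha>\<^sup>2"] by simp
      then show False using X by (simp add: algebra_simps)
    qed
  qed
qed

lemma eq_zero_of_abs_le_mult:
  fixes x P b :: real
  assumes "b > 0" and le: "\<And>a. 0 < a \<Longrightarrow> a < b \<Longrightarrow> \<bar>x\<bar> \<le> P * a"
  shows "x = 0"
proof (rule ccontr)
  assume "x \<noteq> 0"
  define a where "a = min (b / 2) (\<bar>x\<bar> / (2 * (\<bar>P\<bar> + 1)))"
  have a: "0 < a" "a < b" using \<open>b > 0\<close> \<open>x \<noteq> 0\<close> by (auto simp: a_def)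
  have "P * a \<le> (\<bar>P\<bar> + 1) * a" using a by (intro mult_right_mono) auto
  also have "\<dots> \<le> (\<bar>P\<bar> + 1) * (\<bar>x\<bar> / (2 * (\<bar>P\<bar> + 1)))"
    by (intro mult_left_mono) (auto simp: a_def)
  also have "\<dots> = \<bar>x\<bar> / 2" by (simp add: field_simps add_nonneg_pos)
  finally show False using le[OF a] \<open>x \<noteq> 0\<close> by auto
qed

subsection \<open>Sobolev norms\<close>

lemma borel_measurable_Hs: "g \<in> Hs s \<Longrightarrow> g \<in> borel_measurable borel"
  by (simp add: Hs_def)

lemma integrable_Hs: "g \<in> Hs s \<Longrightarrow> integrable lborel (\<lambda>\<xi>. (1 + \<xi>\<^sup>2) powr s * (cmod (g \<xi>))\<^sup>2)"
  by (simp add: Hs_def)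

lemma hs_norm_nonneg [simp]: "hs_norm s g \<ge> 0"
  by (simp add: hs_norm_def)

lemma hs_norm_sq: "(hs_norm s g)\<^sup>2 = (LINT \<xi>|lborel. (1 + \<xi>\<^sup>2) powr s * (cmod (g \<xi>))\<^sup>2)"
  by (simp add: hs_norm_def)

lemma hs_norm_zero [simp]: "hs_norm s (\<lambda>_. 0) = 0"
  by (simp add: hs_norm_def)

lemma zero_in_Hs: "(\<lambda>_. 0) \<in> Hs s"
  by (simp add: Hs_def)

lemma hs_norm_scale: "hs_norm s (\<lambda>\<xi>. complex_of_real a * g \<xi>) = \<bar>a\<bar> * hs_norm s g"
proof -
  have "(LINT \<xi>|lborel. (1 + \<xi>\<^sup>2) powr s * (cmod (complex_of_real a * g \<xi>))\<^sup>2)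
    = (LINT \<xi>|lborel. a\<^sup>2 * ((1 + \<xi>\<^sup>2) powr s * (cmod (g \<xi>))\<^sup>2))"
    by (rule Bochner_Integration.integral_cong) (auto simp: norm_mult power_mult_distrib)
  then show ?thesis by (simp add: hs_norm_def real_sqrt_mult)
qed

lemma Hs_scale:
  assumes "g \<in> Hs s" shows "(\<lambda>\<xi>. complex_of_real a * g \<xi>) \<in> Hs s"
proof -
  have "integrable lborel (\<lambda>\<xi>. a\<^sup>2 * ((1 + \<xi>\<^sup>2) powr s * (cmod (g \<xi>))\<^sup>2))"
    using integrable_Hs[OF assms] by (rule integrable_mult_right)
  then have "integrable lborel (\<lambda>\<xi>. (1 + \<xi>\<^sup>2) powr s * (cmod (complex_of_real a * g \<xi>))\<^sup>2)"
    by (rule iffD1[OF Bochner_Integration.integrable_cong, rotated -1])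
       (auto simp: norm_mult power_mult_distrib)
  then show ?thesis using assms by (auto simp: Hs_def)
qed

text \<open>Young's inequality with a free weight c, which can be optimised after
  integration.\<close>

lemma cmod_add_sq_le:
  assumes "c > (0::real)"
  shows "(cmod (x + y))\<^sup>2 \<le> (1 + c) * (cmod x)\<^sup>2 + (1 + 1 / c) * (cmod y)\<^sup>2"
proof -
  have "(cmod (x + y))\<^sup>2 \<le> (cmod x + cmod y)\<^sup>2"
    by (intro power_mono norm_triangle_ineq) auto
  also have "\<dots> = (cmod x)\<^sup>2 + (cmod y)\<^sup>2 + 2 * cmod x * cmod y"
    by (simp add: power2_eq_square algebra_simps)
  also have "2 * cmod x * cmod y \<le> c * (cmod x)\<^sup>2 + (cmod y)\<^sup>2 / c"
  proof -
    have "0 \<le> (c * cmod x - cmod y)\<^sup>2 / c" using assms by simp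
    also have "\<dots> = c * (cmod x)\<^sup>2 + (cmod y)\<^sup>2 / c - 2 * cmod x * cmod y"
      using assms by (simp add: power2_eq_square field_simps)
    finally show ?thesis by simp
  qed
  finally show ?thesis by (simp add: algebra_simps)
qed

lemma Hs_add:
  assumes f: "f \<in> Hs s" and g: "g \<in> Hs s"
  shows "(\<lambda>\<xi>. f \<xi> + g \<xi>) \<in> Hs s"
proof -
  note [measurable] = borel_measurable_Hs[OF f] borel_measurable_Hs[OF g]
  have "integrable lborel (\<lambda>\<xi>. (1 + \<xi>\<^sup>2) powr s * (cmod (f \<xi> + g \<xi>))\<^sup>2)"
  proof (rule Bochner_Integration.integrable_bound)
    show "integrable lborel (\<lambda>\<xi>. 2 * ((1 + \<xi>\<^sup>2) powr s * (cmod (f \<xi>))\<^sup>2) + 2 * ((1 + \<xi>\<^sup>2) powr s * (cmod (g \<xi>))\<^sup>2))"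
      using integrable_Hs[OF f] integrable_Hs[OF g] by auto
    have "(1 + \<xi>\<^sup>2) powr s * (cmod (f \<xi> + g \<xi>))\<^sup>2
        \<le> (1 + \<xi>\<^sup>2) powr s * (2 * (cmod (f \<xi>))\<^sup>2 + 2 * (cmod (g \<xi>))\<^sup>2)" for \<xi>
      using cmod_add_sq_le[of 1 "f \<xi>" "g \<xi>"] by (intro mult_left_mono) auto
    then show "AE \<xi> in lborel. norm ((1 + \<xi>\<^sup>2) powr s * (cmod (f \<xi> + g \<xi>))\<^sup>2)
      \<le> norm (2 * ((1 + \<xi>\<^sup>2) powr s * (cmod (f \<xi>))\<^sup>2) + 2 * ((1 + \<xi>\<^sup>2) powr s * (cmod (g \<xi>))\<^sup>2))"
      by (intro AE_I2) (auto simp: algebra_simps)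
  qed measurable
  moreover have "AE \<xi> in lborel. f (- \<xi>) + g (- \<xi>) = cnj (f \<xi> + g \<xi>)"
    using f g unfolding Hs_def by auto
  ultimately show ?thesis by (auto simp: Hs_def)
qed

lemma Hs_diff:
  assumes f: "f \<in> Hs s" and g: "g \<in> Hs s"
  shows "(\<lambda>\<xi>. f \<xi> - g \<xi>) \<in> Hs s"
  using Hs_add[OF f Hs_scale[OF g, of "-1"]] by simp

text \<open>Integrating the weighted Young inequality for every c bounds the cross term, and
  \<open>le_two_mult_of_weighted\<close> then picks the best c.\<close>

lemma hs_norm_triangle:
  assumes f: "f \<in> Hs s" and g: "g \<in> Hs s"
  shows "hs_norm s (\<lambda>\<xi>. f \<xi> + g \<xi>) \<le> hs_norm s f + hs_norm s g"
proof -
  let ?w = "\<lambda>\<xi>::real. (1 + \<xi>\<^sup>2) powr s"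
  have "(hs_norm s (\<lambda>\<xi>. f \<xi> + g \<xi>))\<^sup>2 - (hs_norm s f)\<^sup>2 - (hs_norm s g)\<^sup>2 \<le> 2 * hs_norm s f * hs_norm s g"
  proof (rule le_two_mult_of_weighted)
    fix c :: real assume c: "c > 0"
    have "(hs_norm s (\<lambda>\<xi>. f \<xi> + g \<xi>))\<^sup>2 \<le>
       (LINT \<xi>|lborel. (1 + c) * (?w \<xi> * (cmod (f \<xi>))\<^sup>2) + (1 + 1 / c) * (?w \<xi> * (cmod (g \<xi>))\<^sup>2))"
      unfolding hs_norm_sq
    proof (rule integral_mono)
      fix \<xi>
      have "?w \<xi> * (cmod (f \<xi> + g \<xi>))\<^sup>2 \<le> ?w \<xi> * ((1 + c) * (cmod (f \<xi>))\<^sup>2 + (1 + 1 / c) * (cmod (g \<xi>))\<^sup>2)"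
        by (intro mult_left_mono cmod_add_sq_le c) auto
      then show "?w \<xi> * (cmod (f \<xi> + g \<xi>))\<^sup>2 \<le>
          (1 + c) * (?w \<xi> * (cmod (f \<xi>))\<^sup>2) + (1 + 1 / c) * (?w \<xi> * (cmod (g \<xi>))\<^sup>2)"
        by (simp add: algebra_simps)
    qed (use integrable_Hs[OF f] integrable_Hs[OF g] integrable_Hs[OF Hs_add[OF f g]] in auto)
    also have "\<dots> = (1 + c) * (hs_norm s f)\<^sup>2 + (1 + 1 / c) * (hs_norm s g)\<^sup>2"
      unfolding hs_norm_sq using integrable_Hs[OF f] integrable_Hs[OF g] by simp
    finally show "(hs_norm s (\<lambda>\<xi>. f \<xi> + g \<xi>))\<^sup>2 - (hs_norm s f)\<^sup>2 - (hs_norm s g)\<^sup>2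
        \<le> c * (hs_norm s f)\<^sup>2 + (hs_norm s g)\<^sup>2 / c"
      by (simp add: algebra_simps)
  qed auto
  then have "(hs_norm s (\<lambda>\<xi>. f \<xi> + g \<xi>))\<^sup>2 \<le> (hs_norm s f + hs_norm s g)\<^sup>2"
    by (simp add: power2_eq_square algebra_simps)
  then show ?thesis by (rule power2_le_imp_le) auto
qed

lemma hs_norm_diff_triangle:
  assumes f: "f \<in> Hs s" and g: "g \<in> Hs s"
  shows "\<bar>hs_norm s f - hs_norm s g\<bar> \<le> hs_norm s (\<lambda>\<xi>. f \<xi> - g \<xi>)"
  using hs_norm_triangle[OF Hs_diff[OF f g] g] hs_norm_triangle[OF Hs_diff[OF g f] f]
    hs_norm_scale[of s "-1" "\<lambda>\<xi>. f \<xi> - g \<xi>"] by simp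

section \<open>Continuous curves in H^s and their supremum norm\<close>

lemma continuous_on_hs_norm:
  assumes "u \<in> CHs s T"
  shows "continuous_on {0..T} (\<lambda>t. hs_norm s (u t))"
  unfolding continuous_on_def
proof
  fix t assume t: "t \<in> {0..T}"
  have lim: "((\<lambda>t'. hs_norm s (\<lambda>\<xi>. u t' \<xi> - u t \<xi>)) \<longlongrightarrow> 0) (at t within {0..T})"
    using assms t by (auto simp: CHs_def)
  have "\<forall>\<^sub>F t' in at t within {0..T}. norm (hs_norm s (u t') - hs_norm s (u t)) \<le> hs_norm s (\<lambda>\<xi>. u t' \<xi> - u t \<xi>) * 1"
    unfolding eventually_at_filter
    by (intro always_eventually allI impI, simp)
       (rule hs_norm_diff_triangle, use assms t in \<open>auto simp: CHs_def\<close>)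
  then have "((\<lambda>t'. hs_norm s (u t') - hs_norm s (u t)) \<longlongrightarrow> 0) (at t within {0..T})"
    using tendsto_0_le[OF lim, of "\<lambda>t'. hs_norm s (u t') - hs_norm s (u t)" 1]
    by simp
  then show "((\<lambda>t. hs_norm s (u t)) \<longlongrightarrow> hs_norm s (u t)) (at t within {0..T})"
    by (simp add: LIM_zero_iff)
qed

text \<open>A real supremum dominates its members only for a bounded family; boundedness comes from
  continuity on the compact interval.\<close>

lemma hs_norm_le_cnorm:
  assumes "u \<in> CHs s T" "t \<in> {0..T}"
  shows "hs_norm s (u t) \<le> cnorm s T u"
  unfolding cnorm_def
proof (rule cSUP_upper[OF assms(2)])
  show "bdd_above ((\<lambda>t. hs_norm s (u t)) ` {0..T})"
    by (intro bounded_imp_bdd_above compact_imp_bounded compact_continuous_image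
        continuous_on_hs_norm[OF assms(1)]) auto
qed

lemma CHs_in_Hs: "u \<in> CHs s T \<Longrightarrow> t \<in> {0..T} \<Longrightarrow> u t \<in> Hs s"
  by (auto simp: CHs_def)

lemma CHs_add:
  assumes u: "u \<in> CHs s T" and v: "v \<in> CHs s T"
  shows "addY u v \<in> CHs s T"
  unfolding CHs_def
proof (intro CollectI conjI ballI)
  fix t assume t: "t \<in> {0..T}"
  then show "addY u v t \<in> Hs s"
    using u v by (auto simp: addY_def CHs_def intro!: Hs_add)
  have lim: "((\<lambda>t'. hs_norm s (\<lambda>\<xi>. u t' \<xi> - u t \<xi>) + hs_norm s (\<lambda>\<xi>. v t' \<xi> - v t \<xi>)) \<longlongrightarrow> 0 + 0) (at t within {0..T})"
    by (rule tendsto_add) (use u v t in \<open>auto simp: CHs_def\<close>)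
  have le: "hs_norm s (\<lambda>\<xi>. addY u v t' \<xi> - addY u v t \<xi>) \<le> hs_norm s (\<lambda>\<xi>. u t' \<xi> - u t \<xi>) + hs_norm s (\<lambda>\<xi>. v t' \<xi> - v t \<xi>)"
    if "t' \<in> {0..T}" for t'
    using hs_norm_triangle[OF Hs_diff[OF CHs_in_Hs[OF u that] CHs_in_Hs[OF u t]]
        Hs_diff[OF CHs_in_Hs[OF v that] CHs_in_Hs[OF v t]]]
    by (simp add: addY_def algebra_simps)
  show "((\<lambda>t'. hs_norm s (\<lambda>\<xi>. addY u v t' \<xi> - addY u v t \<xi>)) \<longlongrightarrow> 0) (at t within {0..T})"
    by (rule tendsto_sandwich[OF _ _ tendsto_const lim[simplified]])
       (auto simp: eventually_at_filter le)
qed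

lemma CHs_scale:
  assumes u: "u \<in> CHs s T"
  shows "scaleY a u \<in> CHs s T"
  unfolding CHs_def
proof (intro CollectI conjI ballI)
  fix t assume t: "t \<in> {0..T}"
  then show "scaleY a u t \<in> Hs s"
    using u by (auto simp: scaleY_def CHs_def intro!: Hs_scale)
  have lim: "((\<lambda>t'. \<bar>a\<bar> * hs_norm s (\<lambda>\<xi>. u t' \<xi> - u t \<xi>)) \<longlongrightarrow> \<bar>a\<bar> * 0) (at t within {0..T})"
    by (rule tendsto_mult_left) (use u t in \<open>auto simp: CHs_def\<close>)
  then show "((\<lambda>t'. hs_norm s (\<lambda>\<xi>. scaleY a u t' \<xi> - scaleY a u t \<xi>)) \<longlongrightarrow> 0) (at t within {0..T})"
    by (simp add: scaleY_def hs_norm_scale flip: right_diff_distrib)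
qed

lemma CHs_diff:
  assumes u: "u \<in> CHs s T" and v: "v \<in> CHs s T"
  shows "subY u v \<in> CHs s T"
  using CHs_add[OF u CHs_scale[OF v, of "-1"]] by (simp add: subY_def addY_def scaleY_def)

section \<open>Real functionals on H^s and linear maps into curves\<close>

text \<open>The conjugation symmetry in \<open>Hs\<close> survives only real scalars, so linearity
  is over the reals. The bound by \<open>hs_norm\<close> makes L blind to differences of norm zero.
  K is kept explicit because its growth in N enters the final comparison.\<close>

definition bounded_functional :: "real \<Rightarrow> real \<Rightarrow> ((real \<Rightarrow> complex) \<Rightarrow> real) \<Rightarrow> bool" where
  "bounded_functional s K L \<longleftrightarrow>
     (\<forall>g\<in>Hs s. \<forall>k\<in>Hs s. L (\<lambda>\<xi>. g \<xi> + k \<xi>) = L g + L k)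
   \<and> (\<forall>g\<in>Hs s. \<forall>a. L (\<lambda>\<xi>. complex_of_real a * g \<xi>) = a * L g)
   \<and> (\<forall>g\<in>Hs s. \<bar>L g\<bar> \<le> K * hs_norm s g)"

lemma bounded_functional_diff:
  assumes "bounded_functional s K L" "f \<in> Hs s" "g \<in> Hs s"
  shows "L (\<lambda>\<xi>. f \<xi> - g \<xi>) = L f - L g"
proof -
  have "L (\<lambda>\<xi>. f \<xi> + complex_of_real (-1) * g \<xi>) = L f + (-1) * L g"
    using assms Hs_scale[OF assms(3), of "-1"] unfolding bounded_functional_def by metis
  then show ?thesis by simp
qed

lemma bounded_functional_cnorm:
  assumes "bounded_functional s K L" "K \<ge> 0" "u \<in> CHs s T" "t \<in> {0..T}"
  shows "\<bar>L (u t)\<bar> \<le> K * cnorm s T u"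
proof -
  have "\<bar>L (u t)\<bar> \<le> K * hs_norm s (u t)"
    using assms CHs_in_Hs unfolding bounded_functional_def by blast
  also have "\<dots> \<le> K * cnorm s T u"
    by (intro mult_left_mono hs_norm_le_cnorm assms)
  finally show ?thesis .
qed

text \<open>\<open>bl1\<close> states additivity and homogeneity jointly and only up to zero
  \<open>cnorm\<close>. Taking the second argument to be 0 isolates homogeneity, since boundedness
  makes L vanish on the image of 0, and L cannot see a curve of zero \<open>cnorm\<close>.\<close>

lemma bl1_scale:
  assumes L: "bounded_functional s K L" "K \<ge> 0" and A: "bl1 s T A" and h: "h \<in> Hs s" and t: "t \<in> {0..T}"
  shows "L (A (scaleX c h) t) = c * L (A h t)"
proof -
  let ?z = "\<lambda>_::real. 0::complex"
  have CH: "A k \<in> CHs s T" if "k \<in> Hs s" for k using A that by (auto simp: bl1_def)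
  obtain C where C: "\<And>h. h \<in> Hs s \<Longrightarrow> cnorm s T (A h) \<le> C * hs_norm s h"
    using A unfolding bl1_def by blast
  have "cnorm s T (A ?z) \<le> 0" using C[OF zero_in_Hs] by simp
  then have "K * cnorm s T (A ?z) \<le> 0" using L(2) by (rule mult_nonneg_nonpos[rotated])
  then have Az: "L (A ?z t) = 0"
    using bounded_functional_cnorm[OF L CH[OF zero_in_Hs] t] by simp
  let ?d = "subY (A (addX (scaleX c h) ?z)) (addY (scaleY c (A h)) (A ?z))"
  have sc: "scaleX c h \<in> Hs s" using Hs_scale[OF h] by (simp add: scaleX_def)
  have eq: "addX (scaleX c h) ?z = scaleX c h" by (simp add: addX_def)
  have "cnorm s T ?d = 0" using A h zero_in_Hs by (auto simp: bl1_def)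
  moreover have "?d \<in> CHs s T" unfolding eq
    by (intro CHs_diff CHs_add CHs_scale CH sc h zero_in_Hs)
  ultimately have "L (?d t) = 0"
    using bounded_functional_cnorm[OF L _ t, of ?d] by simp
  moreover have "L (?d t) = L (A (scaleX c h) t) - (c * L (A h t) + L (A ?z t))"
  proof -
    note H = CHs_in_Hs[OF CH t]
    have "L (?d t) = L (A (scaleX c h) t) - L (\<lambda>\<xi>. complex_of_real c * A h t \<xi> + A ?z t \<xi>)"
      unfolding eq subY_def addY_def scaleY_def
      by (rule bounded_functional_diff[OF L(1)]) (intro H sc h Hs_add Hs_scale zero_in_Hs)+
    also have "L (\<lambda>\<xi>. complex_of_real c * A h t \<xi> + A ?z t \<xi>) = c * L (A h t) + L (A ?z t)"
      using L(1) H[OF h] H[OF zero_in_Hs] Hs_scale[OF H[OF h]] unfolding bounded_functional_def by metis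
    finally show ?thesis .
  qed
  ultimately show ?thesis using Az by simp
qed

subsection \<open>Second-order differentiability of the flow at zero\<close>

lemma scaleX_in_Hs: "h \<in> Hs s \<Longrightarrow> scaleX a h \<in> Hs s"
  by (simp add: scaleX_def Hs_scale)

lemma hs_norm_scaleX: "hs_norm s (scaleX a h) = \<bar>a\<bar> * hs_norm s h"
  by (simp add: scaleX_def hs_norm_scale)

lemma addX_scaleX: "addX (scaleX a h) (scaleX b h) = scaleX (a + b) h"
  by (simp add: addX_def scaleX_def algebra_simps)

lemma bounded_functional_subY_le:
  assumes L: "bounded_functional s K L" "K \<ge> 0" and "u \<in> CHs s T" "v \<in> CHs s T" "w \<in> CHs s T"
    and t: "t \<in> {0..T}"
  shows "\<bar>L (u t) - L (v t) - L (w t)\<bar> \<le> K * cnorm s T (subY (subY u v) w)"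
proof -
  note H = CHs_in_Hs[OF assms(3) t] CHs_in_Hs[OF assms(4) t] CHs_in_Hs[OF assms(5) t]
  have "L (subY (subY u v) w t) = L (u t) - L (v t) - L (w t)"
    using bounded_functional_diff[OF L(1) Hs_diff[OF H(1) H(2)] H(3)]
      bounded_functional_diff[OF L(1) H(1,2)] by (simp add: subY_def)
  then show ?thesis
    using bounded_functional_cnorm[OF L CHs_diff[OF CHs_diff[OF assms(3,4)] assms(5)] t] by simp
qed

text \<open>The constant \<open>C\<close> does not depend on \<open>h\<close>, \<open>t\<close>, \<open>L\<close>; the a priori rate \<open>M * a\<^sup>2\<close>, with \<open>M\<close>
  arbitrary, only serves to make the value and the first derivative at \<open>a = 0\<close> vanish.\<close>
definition quadratic_flow_bound ::
  "real \<Rightarrow> real \<Rightarrow> ((real \<Rightarrow> complex) \<Rightarrow> real \<Rightarrow> real \<Rightarrow> complex) \<Rightarrow> real \<Rightarrow> bool" where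
  "quadratic_flow_bound s T \<Phi> C \<longleftrightarrow>
    (\<forall>h\<in>Hs s. \<forall>t\<in>{0..T}. \<forall>L K M a1. bounded_functional s K L \<longrightarrow> K \<ge> 0 \<longrightarrow> a1 > 0 \<longrightarrow>
      (\<forall>a>0. a < a1 \<longrightarrow> \<bar>L (\<Phi> (scaleX a h) t)\<bar> \<le> M * a\<^sup>2) \<longrightarrow>
      (\<exists>a0>0. \<forall>a>0. a < a0 \<longrightarrow> \<bar>L (\<Phi> (scaleX a h) t)\<bar> \<le> K * C * a\<^sup>2 * (hs_norm s h)\<^sup>2))"

text \<open>Along the ray, G a = L (\<Phi> (a h) t) has derivative G' a = L (D1 (a h) h t) near 0,
  and differentiability of \<open>D1\<close> at 0 bounds G' a - G' 0 linearly in a. The mean value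
  theorem turns this into a second-order Taylor bound, and the assumed quadratic rate leaves no room
  for nonzero G 0 or G' 0.\<close>

lemma flow_second_order:
  assumes C3: "C3_near_zero s T \<Phi>" and \<Phi>: "\<And>\<phi>. \<phi> \<in> Hs s \<Longrightarrow> \<Phi> \<phi> \<in> CHs s T"
  obtains C where "C \<ge> 0" "quadratic_flow_bound s T \<Phi> C"
proof -
  obtain \<delta> D1 D2 D3 where \<delta>: "\<delta> > 0"
    and D: "\<And>\<phi>. \<phi> \<in> Hs s \<Longrightarrow> hs_norm s \<phi> < \<delta> \<Longrightarrow>
        bl1 s T (D1 \<phi>) \<and> bl2 s T (D2 \<phi>) \<and> bl3 s T (D3 \<phi>)
      \<and> (\<forall>\<epsilon>>0. \<exists>d>0. \<forall>h\<in>Hs s. hs_norm s h < d \<longrightarrow>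
           cnorm s T (subY (subY (\<Phi> (addX \<phi> h)) (\<Phi> \<phi>)) (D1 \<phi> h)) \<le> \<epsilon> * hs_norm s h)
      \<and> (\<forall>\<epsilon>>0. \<exists>d>0. \<forall>h\<in>Hs s. hs_norm s h < d \<longrightarrow> (\<forall>k\<in>Hs s.
           cnorm s T (subY (subY (D1 (addX \<phi> h) k) (D1 \<phi> k)) (D2 \<phi> h k))
             \<le> \<epsilon> * hs_norm s h * hs_norm s k))"
    using C3 unfolding C3_near_zero_def by metis
  have bl1: "bl1 s T (D1 \<phi>)" if "\<phi> \<in> Hs s" "hs_norm s \<phi> < \<delta>" for \<phi> using D[OF that] by blast
  have D1CH: "D1 \<phi> k \<in> CHs s T" if "\<phi> \<in> Hs s" "hs_norm s \<phi> < \<delta>" "k \<in> Hs s" for \<phi> k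
    using bl1[OF that(1,2)] that(3) unfolding bl1_def by blast
  have deriv1: "\<exists>d>0. \<forall>h\<in>Hs s. hs_norm s h < d \<longrightarrow>
           cnorm s T (subY (subY (\<Phi> (addX \<phi> h)) (\<Phi> \<phi>)) (D1 \<phi> h)) \<le> \<epsilon> * hs_norm s h"
    if "\<phi> \<in> Hs s" "hs_norm s \<phi> < \<delta>" "\<epsilon> > 0" for \<phi> \<epsilon> using D[OF that(1,2)] that(3) by blast
  let ?z = "\<lambda>_::real. 0::complex"
  have z: "?z \<in> Hs s" "hs_norm s ?z < \<delta>" using \<delta> by (auto simp: zero_in_Hs)
  have bl2: "bl2 s T (D2 ?z)" using D[OF z] by blast
  have D2CH: "D2 ?z h k \<in> CHs s T" if "h \<in> Hs s" "k \<in> Hs s" for h k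
    using bl2 that unfolding bl2_def bl1_def by blast
  obtain C2 where C2: "\<And>h k. h \<in> Hs s \<Longrightarrow> k \<in> Hs s \<Longrightarrow> cnorm s T (D2 ?z h k) \<le> C2 * hs_norm s h * hs_norm s k"
    using bl2 unfolding bl2_def by blast
  \<comment> \<open>Differentiability of \<open>D1\<close> at 0 is taken with \<epsilon> = 1; this
    error and the bound \<open>C2\<close> of \<open>D2\<close> at 0 add up to the final constant
    \<open>\<bar>C2\<bar> + 1\<close>.\<close>
  obtain d where d: "d > 0" and dd: "\<And>h k. h \<in> Hs s \<Longrightarrow> hs_norm s h < d \<Longrightarrow> k \<in> Hs s \<Longrightarrow>
     cnorm s T (subY (subY (D1 (addX ?z h) k) (D1 ?z k)) (D2 ?z h k)) \<le> 1 * hs_norm s h * hs_norm s k"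
    using D[OF z] zero_less_one by metis
  show thesis
  proof (rule that[of "\<bar>C2\<bar> + 1"], simp, unfold quadratic_flow_bound_def, intro ballI allI impI)
    fix h t L K M a1
    assume h: "h \<in> Hs s" and t: "t \<in> {0..T}" and L: "bounded_functional s K L" "K \<ge> 0" and a1: "a1 > (0::real)"
      and "\<forall>a>0. a < a1 \<longrightarrow> \<bar>L (\<Phi> (scaleX a h) t)\<bar> \<le> M * a\<^sup>2"
    then have small: "\<And>a. 0 < a \<Longrightarrow> a < a1 \<Longrightarrow> \<bar>L (\<Phi> (scaleX a h) t)\<bar> \<le> M * a\<^sup>2" by simp
    define n where "n = hs_norm s h"
    have n: "n \<ge> 0" by (simp add: n_def)
    \<comment> \<open>For |a| < r the point a h lies in both balls; n + 1 avoids division by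
      zero.\<close>
    define r where "r = min \<delta> d / (n + 1)"
    have r: "r > 0" using \<delta> d n by (simp add: r_def)
    have ball: "hs_norm s (scaleX a h) < \<delta>" "hs_norm s (scaleX a h) < d" if "\<bar>a\<bar> < r" for a
    proof -
      have "\<bar>a\<bar> * n \<le> \<bar>a\<bar> * (n + 1)" by (intro mult_left_mono) auto
      also have "\<dots> < r * (n + 1)" using that n by (intro mult_strict_right_mono) auto
      also have "\<dots> = min \<delta> d" using n by (simp add: r_def)
      finally show "hs_norm s (scaleX a h) < \<delta>" "hs_norm s (scaleX a h) < d"
        by (auto simp: hs_norm_scaleX n_def)
    qed
    define G where "G a = L (\<Phi> (scaleX a h) t)" for a
    define G' where "G' a = L (D1 (scaleX a h) h t)" for a
    note sh = scaleX_in_Hs[OF h]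
    \<comment> \<open>Chain rule along the ray: the increment (y - a) h is tested against
      \<open>D1\<close> at a h, and \<open>bl1_scale\<close> pulls out the factor y - a.\<close>
    have der: "(G has_derivative (\<lambda>x. x * G' a)) (at a)" if a: "\<bar>a\<bar> < r" for a
      unfolding has_derivative_at_alt
    proof (intro conjI allI impI)
      show "bounded_linear (\<lambda>x. x * G' a)" by (rule bounded_linear_mult_left)
      fix e :: real assume e: "e > 0"
      define \<epsilon> where "\<epsilon> = e / (K * n + 1)"
      have Kn: "K * n + 1 > 0" using L(2) n by (simp add: add_nonneg_pos)
      have \<epsilon>: "\<epsilon> > 0" "K * n * \<epsilon> \<le> e"
      proof -
        show "\<epsilon> > 0" using e Kn by (simp add: \<epsilon>_def)
        then have "K * n * \<epsilon> \<le> (K * n + 1) * \<epsilon>" by (intro mult_right_mono) auto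
        then show "K * n * \<epsilon> \<le> e" using Kn by (simp add: \<epsilon>_def)
      qed
      obtain d' where d': "d' > 0" and le: "\<And>k. k \<in> Hs s \<Longrightarrow> hs_norm s k < d' \<Longrightarrow>
         cnorm s T (subY (subY (\<Phi> (addX (scaleX a h) k)) (\<Phi> (scaleX a h))) (D1 (scaleX a h) k)) \<le> \<epsilon> * hs_norm s k"
        using deriv1[OF sh ball(1)[OF a] \<epsilon>(1)] by blast
      show "\<exists>d>0. \<forall>y. norm (y - a) < d \<longrightarrow> norm (G y - G a - (y - a) * G' a) \<le> e * norm (y - a)"
      proof (intro exI conjI allI impI)
        show "d' / (n + 1) > 0" using d' n by simp
        fix y assume y: "norm (y - a) < d' / (n + 1)"
        let ?k = "scaleX (y - a) h"
        have "\<bar>y - a\<bar> * n \<le> \<bar>y - a\<bar> * (n + 1)" by (intro mult_left_mono) auto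
        also have "\<dots> < d' / (n + 1) * (n + 1)" using y n by (intro mult_strict_right_mono) auto
        finally have k: "hs_norm s ?k < d'" using n d' by (simp add: hs_norm_scaleX n_def split: if_splits)
        have "norm (G y - G a - (y - a) * G' a) = \<bar>L (\<Phi> (addX (scaleX a h) ?k) t) - L (\<Phi> (scaleX a h) t) - L (D1 (scaleX a h) ?k t)\<bar>"
          unfolding G_def G'_def bl1_scale[OF L bl1[OF sh ball(1)[OF a]] h t] addX_scaleX by simp
        also have "\<dots> \<le> K * cnorm s T (subY (subY (\<Phi> (addX (scaleX a h) ?k)) (\<Phi> (scaleX a h))) (D1 (scaleX a h) ?k))"
          unfolding addX_scaleX by (intro bounded_functional_subY_le L \<Phi> sh D1CH ball t a)
        also have "\<dots> \<le> K * (\<epsilon> * hs_norm s ?k)"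
          by (intro mult_left_mono le sh k L)
        also have "\<dots> = (K * n * \<epsilon>) * \<bar>y - a\<bar>" by (simp add: hs_norm_scaleX n_def)
        also have "\<dots> \<le> e * norm (y - a)" using \<epsilon>(2) by (simp add: mult_right_mono)
        finally show "norm (G y - G a - (y - a) * G' a) \<le> e * norm (y - a)" .
      qed
    qed
    let ?C = "\<bar>C2\<bar> + 1"
    have G'le: "\<bar>G' a - G' 0\<bar> \<le> K * ?C * \<bar>a\<bar> * n\<^sup>2" if a: "\<bar>a\<bar> < r" for a
    proof -
      have eq: "addX ?z (scaleX a h) = scaleX a h" "scaleX 0 h = ?z" by (auto simp: addX_def scaleX_def)
      have "\<bar>L (D1 (scaleX a h) h t) - L (D1 ?z h t) - L (D2 ?z (scaleX a h) h t)\<bar>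
          \<le> K * cnorm s T (subY (subY (D1 (scaleX a h) h) (D1 ?z h)) (D2 ?z (scaleX a h) h))"
        by (intro bounded_functional_subY_le L D1CH D2CH sh z ball t a h)
      also have "\<dots> \<le> K * (1 * hs_norm s (scaleX a h) * hs_norm s h)"
        using dd[OF sh ball(2)[OF a] h] L(2) by (intro mult_left_mono) (auto simp: eq)
      finally have 1: "\<bar>L (D1 (scaleX a h) h t) - L (D1 ?z h t) - L (D2 ?z (scaleX a h) h t)\<bar> \<le> K * \<bar>a\<bar> * n\<^sup>2"
        by (simp add: hs_norm_scaleX n_def power2_eq_square)
      have "\<bar>L (D2 ?z (scaleX a h) h t)\<bar> \<le> K * cnorm s T (D2 ?z (scaleX a h) h)"
        by (intro bounded_functional_cnorm L D2CH sh h t)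
      also have "\<dots> \<le> K * (C2 * hs_norm s (scaleX a h) * hs_norm s h)"
        by (intro mult_left_mono C2 sh h L)
      also have "\<dots> \<le> K * (\<bar>C2\<bar> * hs_norm s (scaleX a h) * hs_norm s h)"
        by (intro mult_left_mono mult_right_mono L) auto
      finally have "\<bar>L (D2 ?z (scaleX a h) h t)\<bar> \<le> K * \<bar>C2\<bar> * \<bar>a\<bar> * n\<^sup>2"
        by (simp add: hs_norm_scaleX n_def power2_eq_square)
      with 1 have "\<bar>G' a - G' 0\<bar> \<le> K * \<bar>a\<bar> * n\<^sup>2 + K * \<bar>C2\<bar> * \<bar>a\<bar> * n\<^sup>2"
        unfolding G'_def eq by linarith
      then show ?thesis by (simp add: algebra_simps)
    qed
    have taylor: "\<bar>G a - G 0 - a * G' 0\<bar> \<le> K * ?C * a\<^sup>2 * n\<^sup>2" if a: "0 < a" "a < r" for a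
    proof -
      \<comment> \<open>Subtracting the linear term first leaves a function with derivative G' x -
        G' 0, which is O(a) on [0, a]; the mean value bound then yields the second power of
        a.\<close>
      have "norm ((G a - a * G' 0) - (G 0 - 0 * G' 0)) \<le> (K * ?C * a * n\<^sup>2) * norm (a - 0)"
      proof (rule differentiable_bound[of "{0..a}"])
        show "convex {0..a}" by simp
        fix x assume x: "x \<in> {0..a}"
        then have xr: "\<bar>x\<bar> < r" using a by auto
        show "((\<lambda>a. G a - a * G' 0) has_derivative (\<lambda>y. y * (G' x - G' 0))) (at x within {0..a})"
          using has_derivative_at_withinI[OF has_derivative_diff[OF der[OF xr]
              has_derivative_mult_left[OF has_derivative_ident, of "G' 0"]]]
          by (simp add: right_diff_distrib)
        show "onorm (\<lambda>y. y * (G' x - G' 0)) \<le> K * ?C * a * n\<^sup>2"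
        proof (rule onorm_bound)
          show "0 \<le> K * ?C * a * n\<^sup>2" using L(2) a by simp
          fix y :: real
          have "\<bar>G' x - G' 0\<bar> \<le> K * ?C * \<bar>x\<bar> * n\<^sup>2" by (rule G'le[OF xr])
          also have "\<dots> \<le> K * ?C * a * n\<^sup>2" using x L(2) by (intro mult_right_mono mult_left_mono) auto
          finally have "\<bar>y\<bar> * \<bar>G' x - G' 0\<bar> \<le> \<bar>y\<bar> * (K * ?C * a * n\<^sup>2)"
            by (intro mult_left_mono) auto
          then show "norm (y * (G' x - G' 0)) \<le> K * ?C * a * n\<^sup>2 * norm y"
            by (simp add: abs_mult mult_ac)
        qed
      qed (use a in auto)
      then show ?thesis using a by (simp add: power2_eq_square algebra_simps)
    qed
    \<comment> \<open>Below a1 the a priori rate holds, below r the Taylor bound, and below 1 one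
      has a^2 \<le> a.\<close>
    define b where "b = Min {a1, r, 1}"
    have b: "b > 0" "b \<le> a1" "b \<le> r" "b \<le> 1" using a1 r by (auto simp: b_def)
    have G0: "G 0 = 0"
    proof (rule eq_zero_of_abs_le_mult[OF b(1)])
      fix a assume a: "0 < a" "a < b"
      have "a\<^sup>2 \<le> a" using a b by (simp add: power2_eq_square mult_le_cancel_left1)
      have "\<bar>G 0\<bar> \<le> \<bar>M\<bar> * a\<^sup>2 + a * \<bar>G' 0\<bar> + K * ?C * n\<^sup>2 * a\<^sup>2"
      proof -
        have "\<bar>a * G' 0\<bar> = a * \<bar>G' 0\<bar>" using a by (simp add: abs_mult)
        moreover have "\<bar>G a\<bar> \<le> M * a\<^sup>2" using small[of a] a b by (simp add: G_def)
        moreover have "M * a\<^sup>2 \<le> \<bar>M\<bar> * a\<^sup>2" by (intro mult_right_mono) auto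
        moreover have "K * ?C * a\<^sup>2 * n\<^sup>2 = K * ?C * n\<^sup>2 * a\<^sup>2" by simp
        ultimately show ?thesis using taylor[of a] a b by linarith
      qed
      also have "\<dots> \<le> \<bar>M\<bar> * a + a * \<bar>G' 0\<bar> + K * ?C * n\<^sup>2 * a"
        using \<open>a\<^sup>2 \<le> a\<close> L(2) a by (intro add_mono mult_left_mono) auto
      finally show "\<bar>G 0\<bar> \<le> (\<bar>M\<bar> + \<bar>G' 0\<bar> + K * ?C * n\<^sup>2) * a" by (simp add: algebra_simps)
    qed
    have G'0: "G' 0 = 0"
    proof (rule eq_zero_of_abs_le_mult[OF b(1)])
      fix a assume a: "0 < a" "a < b"
      have "\<bar>a * G' 0\<bar> \<le> M * a\<^sup>2 + K * ?C * a\<^sup>2 * n\<^sup>2"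
        using taylor[of a] a b small[of a] G0 by (simp add: G_def)
      then have "a * \<bar>G' 0\<bar> \<le> a * ((M + K * ?C * n\<^sup>2) * a)"
        using a by (simp add: abs_mult power2_eq_square algebra_simps)
      then show "\<bar>G' 0\<bar> \<le> (M + K * ?C * n\<^sup>2) * a" using a by simp
    qed
    show "\<exists>a0>0. \<forall>a>0. a < a0 \<longrightarrow> \<bar>L (\<Phi> (scaleX a h) t)\<bar> \<le> K * ?C * a\<^sup>2 * (hs_norm s h)\<^sup>2"
      using taylor b G0 G'0 by (intro exI[of _ r]) (auto simp: G_def n_def r)
  qed
qed

subsection \<open>A priori bounds for the integral equation\<close>

lemma one_plus_sq_pos [simp]: "1 + x\<^sup>2 > (0::real)"
  by (simp add: add_pos_nonneg)

lemma one_plus_sq_nonzero [simp]: "1 + x\<^sup>2 \<noteq> (0::real)"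
  using one_plus_sq_pos[of x] by linarith

lemma integrable_inverse_one_plus_sq: "integrable lborel (\<lambda>x::real. 1 / (1 + x\<^sup>2))"
proof -
  have "set_integrable lborel (einterval (-\<infinity>) \<infinity>) (\<lambda>x::real. 1 / (1 + x\<^sup>2))"
  proof (rule interval_integral_FTC_nonneg)
    show "DERIV arctan x :> 1 / (1 + x\<^sup>2)" for x
      using DERIV_arctan[of x] by (simp add: divide_inverse)
    show "isCont (\<lambda>x::real. 1 / (1 + x\<^sup>2)) x" for x
      by (intro continuous_intros) simp
    show "((arctan \<circ> real_of_ereal) \<longlongrightarrow> - (pi / 2)) (at_right (-\<infinity>))"
      by (simp add: ereal_tendsto_simps tendsto_arctan_at_bot)
    show "((arctan \<circ> real_of_ereal) \<longlongrightarrow> pi / 2) (at_left \<infinity>)"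
      by (simp add: ereal_tendsto_simps tendsto_arctan_at_top)
  qed auto
  then show ?thesis by (simp add: set_integrable_def einterval_def)
qed

text \<open>The factor \<open>\<bar>\<xi>\<bar>\<close> comes from the derivative in the nonlinearity, the factor \<open>1 / (1 + \<xi>\<^sup>2)\<close> from
  integrating the dissipative semigroup in time.\<close>
definition duhamel_weight :: "real \<Rightarrow> real" where "duhamel_weight \<xi> = \<bar>\<xi>\<bar> / (1 + \<xi>\<^sup>2)"

lemma borel_measurable_duhamel_weight [measurable]: "duhamel_weight \<in> borel_measurable borel"
  unfolding duhamel_weight_def[abs_def] by measurable

lemma duhamel_weight_nonneg [simp]: "duhamel_weight \<xi> \<ge> 0"
  by (simp add: duhamel_weight_def)

lemma duhamel_weight_sq_le: "(duhamel_weight \<xi>)\<^sup>2 \<le> 1 / (1 + \<xi>\<^sup>2)"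
proof -
  have "(duhamel_weight \<xi>)\<^sup>2 = (\<xi>\<^sup>2 / (1 + \<xi>\<^sup>2)) * (1 / (1 + \<xi>\<^sup>2))"
    by (simp add: duhamel_weight_def power_divide power2_eq_square)
  also have "\<dots> \<le> 1 * (1 / (1 + \<xi>\<^sup>2))"
    by (intro mult_right_mono) (auto simp: divide_le_eq)
  finally show ?thesis by simp
qed

text \<open>The weight decays only like 1 / |\<xi>|, so it is square integrable but not integrable;
  this matches estimates in L^2.\<close>

lemma integrable_duhamel_weight_sq: "integrable lborel (\<lambda>\<xi>. (duhamel_weight \<xi>)\<^sup>2)"
  by (rule Bochner_Integration.integrable_bound[OF integrable_inverse_one_plus_sq]) (auto simp: duhamel_weight_sq_le)

section \<open>Decay of the semigroup and the Duhamel integral\<close>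

lemma cmod_phase: "cmod (phase \<beta> \<eta> \<tau> \<xi>) = exp (- \<eta> * (\<xi>\<^sup>2 - \<bar>\<xi>\<bar>) * \<tau>)"
  by (simp add: phase_def)

lemma phase_zero [simp]: "phase \<beta> \<eta> 0 \<xi> = 1"
  by (simp add: phase_def zero_complex.code[symmetric])

lemma borel_measurable_phase [measurable]: "phase \<beta> \<eta> \<tau> \<in> borel_measurable borel"
  unfolding phase_def[abs_def] Complex_eq by measurable

text \<open>Frequencies with 0 < |\<xi>| < 1 are amplified. The inequality |\<xi>| \<le> (1 +
  \<xi>^2) / 2 absorbs this growth into the factor \<open>exp (\<eta> * T)\<close> and leaves decay
  at the rate \<eta> (1 + \<xi>^2) / 2 for every frequency.\<close>

lemma cmod_phase_le:
  assumes "\<eta> > 0" "0 \<le> \<tau>" "\<tau> \<le> T"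
  shows "cmod (phase \<beta> \<eta> \<tau> \<xi>) \<le> exp (\<eta> * T) * exp (- (\<eta> * (1 + \<xi>\<^sup>2) / 2) * \<tau>)"
proof -
  have "0 \<le> (\<bar>\<xi>\<bar> - 1)\<^sup>2" by simp
  then have "\<bar>\<xi>\<bar> \<le> (1 + \<xi>\<^sup>2) / 2" by (simp add: power2_eq_square algebra_simps abs_if split: if_splits)
  then have "- (\<xi>\<^sup>2 - \<bar>\<xi>\<bar>) \<le> 1 - (1 + \<xi>\<^sup>2) / 2" by (simp add: field_simps)
  then have "\<eta> * \<tau> * (- (\<xi>\<^sup>2 - \<bar>\<xi>\<bar>)) \<le> \<eta> * \<tau> * (1 - (1 + \<xi>\<^sup>2) / 2)"
    using assms by (intro mult_left_mono) auto
  also have "\<dots> = \<eta> * \<tau> + (- (\<eta> * (1 + \<xi>\<^sup>2) / 2) * \<tau>)" by (simp add: algebra_simps)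
  also have "\<dots> \<le> \<eta> * T + (- (\<eta> * (1 + \<xi>\<^sup>2) / 2) * \<tau>)"
    using assms by (intro add_right_mono mult_left_mono) auto
  finally show ?thesis
    by (simp add: cmod_phase exp_add[symmetric] algebra_simps)
qed

lemma cmod_phase_le_exp:
  assumes "\<eta> > 0" "0 \<le> \<tau>" "\<tau> \<le> T"
  shows "cmod (phase \<beta> \<eta> \<tau> \<xi>) \<le> exp (\<eta> * T)"
proof -
  have "exp (- (\<eta> * (1 + \<xi>\<^sup>2) / 2) * \<tau>) \<le> 1" using assms by simp
  then have "exp (\<eta> * T) * exp (- (\<eta> * (1 + \<xi>\<^sup>2) / 2) * \<tau>) \<le> exp (\<eta> * T) * 1"
    by (intro mult_left_mono) auto
  from order_trans[OF cmod_phase_le[OF assms] this] show ?thesis by (simp only: mult_1_right)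
qed

text \<open>The integral of exp (-c (t - t')) over [0, t] is at most 1 / c, here with c = \<eta> (1
  + \<xi>^2) / 2: dissipation gains two powers of \<xi>, one more than the derivative in the
  nonlinearity costs. No power of t appears, so smallness has to come from the amplitude.\<close>

lemma duhamel_bound:
  assumes \<eta>: "\<eta> > 0" and t: "0 \<le> t" "t \<le> T" and B: "B \<ge> 0"
    and int: "set_integrable lborel {0..t} (\<lambda>t'. phase \<beta> \<eta> (t - t') \<xi> * f t')"
    and f: "\<And>t'. t' \<in> {0..t} \<Longrightarrow> cmod (f t') \<le> B"
  shows "cmod (set_lebesgue_integral lborel {0..t} (\<lambda>t'. phase \<beta> \<eta> (t - t') \<xi> * f t'))
    \<le> exp (\<eta> * T) * B * 2 / (\<eta> * (1 + \<xi>\<^sup>2))"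
proof -
  define c where "c = \<eta> * (1 + \<xi>\<^sup>2) / 2"
  have c: "c > 0" using \<eta> by (simp add: c_def)
  let ?g = "\<lambda>t'. exp (\<eta> * T) * B * exp (- c * (t - t'))"
  have g: "continuous_on {0..t} ?g" by (intro continuous_intros)
  have "cmod (set_lebesgue_integral lborel {0..t} (\<lambda>t'. phase \<beta> \<eta> (t - t') \<xi> * f t'))
      \<le> (LINT t':{0..t}|lborel. cmod (phase \<beta> \<eta> (t - t') \<xi> * f t'))"
    by (rule set_integral_norm_bound[OF int])
  also have "\<dots> \<le> (LINT t':{0..t}|lborel. ?g t')"
  proof (rule set_integral_mono)
    show "set_integrable lborel {0..t} (\<lambda>t'. cmod (phase \<beta> \<eta> (t - t') \<xi> * f t'))"
      using int by (rule set_integrable_norm)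
    show "set_integrable lborel {0..t} ?g" by (rule borel_integrable_atLeastAtMost'[OF g])
    fix t' assume t': "t' \<in> {0..t}"
    have "cmod (phase \<beta> \<eta> (t - t') \<xi>) \<le> exp (\<eta> * T) * exp (- c * (t - t'))"
      using cmod_phase_le[of \<eta> "t - t'" T \<beta> \<xi>] \<eta> t t' unfolding c_def by simp
    then have "cmod (phase \<beta> \<eta> (t - t') \<xi> * f t') \<le> exp (\<eta> * T) * exp (- c * (t - t')) * B"
      unfolding norm_mult by (intro mult_mono f t') auto
    then show "cmod (phase \<beta> \<eta> (t - t') \<xi> * f t') \<le> ?g t'" by (simp add: mult_ac)
  qed
  also have "\<dots> = exp (\<eta> * T) * B / c * exp (- c * (t - t)) - exp (\<eta> * T) * B / c * exp (- c * (t - 0))"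
    unfolding set_lebesgue_integral_def
    using c by (intro integral_FTC_atLeastAtMost[OF t(1) _ g])
      (auto intro!: derivative_eq_intros simp flip: has_real_derivative_iff_has_vector_derivative)
  also have "\<dots> \<le> exp (\<eta> * T) * B / c" using c B by simp
  also have "\<dots> = exp (\<eta> * T) * B * 2 / (\<eta> * (1 + \<xi>\<^sup>2))" by (simp add: c_def)
  finally show ?thesis .
qed

section \<open>Convolution squares of L^2 functions\<close>

lemma integrable_Hs0: "g \<in> Hs 0 \<Longrightarrow> integrable lborel (\<lambda>\<xi>. (cmod (g \<xi>))\<^sup>2)"
  using integrable_Hs[of g 0] by simp

lemma hs_norm0_sq: "(hs_norm 0 g)\<^sup>2 = (LINT \<xi>|lborel. (cmod (g \<xi>))\<^sup>2)"
  by (simp add: hs_norm_sq)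

lemma integrable_convolution:
  assumes v: "v \<in> Hs 0"
  shows "integrable lborel (\<lambda>\<zeta>. v (\<xi> - \<zeta>) * v \<zeta>)"
proof (rule Bochner_Integration.integrable_bound)
  note [measurable] = borel_measurable_Hs[OF v]
  have "integrable lborel (\<lambda>\<zeta>. (cmod (v (\<xi> - \<zeta>)))\<^sup>2)"
    using lborel_integrable_real_affine[OF integrable_Hs0[OF v], of "-1" \<xi>] by simp
  then show "integrable lborel (\<lambda>\<zeta>. ((cmod (v (\<xi> - \<zeta>)))\<^sup>2 + (cmod (v \<zeta>))\<^sup>2) / 2)"
    using integrable_Hs0[OF v] by auto
  show "(\<lambda>\<zeta>. v (\<xi> - \<zeta>) * v \<zeta>) \<in> borel_measurable lborel" by measurable
  have "cmod (v (\<xi> - \<zeta>)) * cmod (v \<zeta>) \<le> ((cmod (v (\<xi> - \<zeta>)))\<^sup>2 + (cmod (v \<zeta>))\<^sup>2) / 2" for \<zeta>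
    using sum_squares_bound[of "cmod (v (\<xi> - \<zeta>))" "cmod (v \<zeta>)"] by simp
  then show "AE \<zeta> in lborel. norm (v (\<xi> - \<zeta>) * v \<zeta>) \<le> norm (((cmod (v (\<xi> - \<zeta>)))\<^sup>2 + (cmod (v \<zeta>))\<^sup>2) / 2)"
    by (auto simp: norm_mult)
qed

text \<open>The integrand is at most half the sum of two squares, and both squares have the same
  integral because \<zeta> |-> \<xi> - \<zeta> preserves Lebesgue measure.\<close>

lemma cmod_convolution_le:
  assumes v: "v \<in> Hs 0"
  shows "cmod (LINT \<zeta>|lborel. v (\<xi> - \<zeta>) * v \<zeta>) \<le> (hs_norm 0 v)\<^sup>2"
proof -
  have i: "integrable lborel (\<lambda>\<zeta>. (cmod (v (\<xi> - \<zeta>)))\<^sup>2)"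
    using lborel_integrable_real_affine[OF integrable_Hs0[OF v], of "-1" \<xi>] by simp
  have "cmod (LINT \<zeta>|lborel. v (\<xi> - \<zeta>) * v \<zeta>) \<le> (LINT \<zeta>|lborel. ((cmod (v (\<xi> - \<zeta>)))\<^sup>2 + (cmod (v \<zeta>))\<^sup>2) / 2)"
  proof (rule Bochner_Integration.integral_norm_bound_integral)
    show "norm (v (\<xi> - \<zeta>) * v \<zeta>) \<le> ((cmod (v (\<xi> - \<zeta>)))\<^sup>2 + (cmod (v \<zeta>))\<^sup>2) / 2" for \<zeta>
      using sum_squares_bound[of "cmod (v (\<xi> - \<zeta>))" "cmod (v \<zeta>)"] by (simp add: norm_mult)
  qed (use integrable_convolution[OF v] i integrable_Hs0[OF v] in auto)
  also have "\<dots> = ((LINT \<zeta>|lborel. (cmod (v (\<xi> - \<zeta>)))\<^sup>2) + (LINT \<zeta>|lborel. (cmod (v \<zeta>))\<^sup>2)) / 2"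
    using i integrable_Hs0[OF v] by simp
  also have "(LINT \<zeta>|lborel. (cmod (v (\<xi> - \<zeta>)))\<^sup>2) = (LINT \<zeta>|lborel. (cmod (v \<zeta>))\<^sup>2)"
    using lborel_integral_real_affine[of "-1" "\<lambda>\<zeta>. (cmod (v \<zeta>))\<^sup>2" \<xi>] by simp
  finally show ?thesis by (simp add: hs_norm0_sq)
qed

section \<open>Mild solutions in L^2: pointwise bound and bootstrap\<close>

text \<open>The nonlinearity contributes |\<xi>| / (4 pi) times the convolution bound B, the Duhamel
  integral 2 exp(\<eta> T) / (\<eta> (1 + \<xi>^2)); the product is the stated constant times the
  weight.\<close>

lemma mild_sol_pointwise:
  assumes \<eta>: "\<eta> > 0" and u: "u \<in> CHs 0 T" and sol: "mild_sol \<beta> \<eta> T g u" and t: "t \<in> {0..T}"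
    and B: "\<And>t'. t' \<in> {0..t} \<Longrightarrow> (hs_norm 0 (u t'))\<^sup>2 \<le> B"
  shows "AE \<xi> in lborel. cmod (u t \<xi> - phase \<beta> \<eta> t \<xi> * g \<xi>) \<le> exp (\<eta> * T) / (2 * pi * \<eta>) * B * duhamel_weight \<xi>"
proof -
  have "AE \<xi> in lborel. set_integrable lborel {0..t} (\<lambda>t'. phase \<beta> \<eta> (t - t') \<xi> * nonlin (u t') \<xi>)
      \<and> u t \<xi> = phase \<beta> \<eta> t \<xi> * g \<xi>
        - set_lebesgue_integral lborel {0..t} (\<lambda>t'. phase \<beta> \<eta> (t - t') \<xi> * nonlin (u t') \<xi>)"
    using sol t unfolding mild_sol_def by (auto elim: AE_mp)
  then show ?thesis
  proof (rule AE_mp, intro AE_I2 impI, elim conjE)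
    fix \<xi>
    assume int: "set_integrable lborel {0..t} (\<lambda>t'. phase \<beta> \<eta> (t - t') \<xi> * nonlin (u t') \<xi>)"
      and eq: "u t \<xi> = phase \<beta> \<eta> t \<xi> * g \<xi>
        - set_lebesgue_integral lborel {0..t} (\<lambda>t'. phase \<beta> \<eta> (t - t') \<xi> * nonlin (u t') \<xi>)"
    have "B \<ge> 0" using B[of t] t order_trans[OF zero_le_power2] by auto
    have nl: "cmod (nonlin (u t') \<xi>) \<le> \<bar>\<xi>\<bar> / (4 * pi) * B" if t': "t' \<in> {0..t}" for t'
    proof -
      have "u t' \<in> Hs 0" using CHs_in_Hs[OF u] t t' by auto
      have "cmod (nonlin (u t') \<xi>) = \<bar>\<xi>\<bar> / (4 * pi) * cmod (LINT \<zeta>|lborel. u t' (\<xi> - \<zeta>) * u t' \<zeta>)"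
        by (simp add: nonlin_def norm_mult norm_divide)
      also have "\<dots> \<le> \<bar>\<xi>\<bar> / (4 * pi) * B"
        using order_trans[OF cmod_convolution_le[OF \<open>u t' \<in> Hs 0\<close>] B[OF t']] by (intro mult_left_mono) auto
      finally show ?thesis .
    qed
    have "cmod (u t \<xi> - phase \<beta> \<eta> t \<xi> * g \<xi>) = cmod (set_lebesgue_integral lborel {0..t} (\<lambda>t'. phase \<beta> \<eta> (t - t') \<xi> * nonlin (u t') \<xi>))"
      unfolding eq by simp
    also have "\<dots> \<le> exp (\<eta> * T) * (\<bar>\<xi>\<bar> / (4 * pi) * B) * 2 / (\<eta> * (1 + \<xi>\<^sup>2))"
      by (rule duhamel_bound[OF \<eta> _ _ _ int nl]) (use t \<open>B \<ge> 0\<close> in auto)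
    also have "\<dots> = exp (\<eta> * T) / (2 * pi * \<eta>) * B * duhamel_weight \<xi>"
      by (simp add: duhamel_weight_def mult_ac)
    finally show "cmod (u t \<xi> - phase \<beta> \<eta> t \<xi> * g \<xi>) \<le> exp (\<eta> * T) / (2 * pi * \<eta>) * B * duhamel_weight \<xi>" .
  qed
qed

text \<open>At time 0 the Duhamel integral runs over a single point. This anchors the bootstrap: the
  curve starts with the norm of its datum.\<close>

lemma mild_sol_initial:
  assumes "T \<ge> 0" and "mild_sol \<beta> \<eta> T g u"
  shows "AE \<xi> in lborel. u 0 \<xi> = g \<xi>"
proof -
  have z: "set_lebesgue_integral lborel {0..0::real} f = 0" for f :: "real \<Rightarrow> complex"
  proof -
    have "AE x in lborel. indicator {0..0::real} x *\<^sub>R f x = 0"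
      using AE_lborel_singleton[of "0::real"] by eventually_elim auto
    then show ?thesis unfolding set_lebesgue_integral_def by (rule integral_eq_zero_AE)
  qed
  have "0 \<in> {0..T}" using assms(1) by simp
  with assms(2) have "AE \<xi> in lborel. u 0 \<xi> = phase \<beta> \<eta> 0 \<xi> * g \<xi>
        - set_lebesgue_integral lborel {0..0} (\<lambda>t'. phase \<beta> \<eta> (0 - t') \<xi> * nonlin (u t') \<xi>)"
    unfolding mild_sol_def by (fastforce elim: AE_mp)
  then show ?thesis by (simp only: z) simp
qed

text \<open>The linear part costs a factor exp(\<eta> T), and the Duhamel part is square integrable
  with the weight. What matters is that B enters the result quadratically, so that a small level
  reproduces itself.\<close>

lemma mild_sol_norm_le:
  assumes \<eta>: "\<eta> > 0" and g: "g \<in> Hs 0" and u: "u \<in> CHs 0 T" and sol: "mild_sol \<beta> \<eta> T g u"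
    and t: "t \<in> {0..T}" and B: "\<And>t'. t' \<in> {0..t} \<Longrightarrow> (hs_norm 0 (u t'))\<^sup>2 \<le> B"
  shows "(hs_norm 0 (u t))\<^sup>2 \<le> 2 * (exp (\<eta> * T))\<^sup>2 * (hs_norm 0 g)\<^sup>2
    + 2 * (exp (\<eta> * T) / (2 * pi * \<eta>))\<^sup>2 * (LINT \<xi>|lborel. (duhamel_weight \<xi>)\<^sup>2) * B\<^sup>2"
proof -
  let ?A = "exp (\<eta> * T)"
  define K where "K = ?A / (2 * pi * \<eta>)"
  have ae: "AE \<xi> in lborel. cmod (u t \<xi> - phase \<beta> \<eta> t \<xi> * g \<xi>) \<le> K * B * duhamel_weight \<xi>"
    by (unfold K_def, rule mild_sol_pointwise[OF \<eta> u sol t B])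
  have "(hs_norm 0 (u t))\<^sup>2 \<le> (LINT \<xi>|lborel. 2 * ?A\<^sup>2 * (cmod (g \<xi>))\<^sup>2 + 2 * K\<^sup>2 * B\<^sup>2 * (duhamel_weight \<xi>)\<^sup>2)"
    unfolding hs_norm0_sq
  proof (rule integral_mono_AE)
    show "integrable lborel (\<lambda>\<xi>. (cmod (u t \<xi>))\<^sup>2)" by (rule integrable_Hs0[OF CHs_in_Hs[OF u t]])
    show "integrable lborel (\<lambda>\<xi>. 2 * ?A\<^sup>2 * (cmod (g \<xi>))\<^sup>2 + 2 * K\<^sup>2 * B\<^sup>2 * (duhamel_weight \<xi>)\<^sup>2)"
      by (intro Bochner_Integration.integrable_add integrable_mult_right integrable_Hs0 g integrable_duhamel_weight_sq)
    show "AE \<xi> in lborel. (cmod (u t \<xi>))\<^sup>2 \<le> 2 * ?A\<^sup>2 * (cmod (g \<xi>))\<^sup>2 + 2 * K\<^sup>2 * B\<^sup>2 * (duhamel_weight \<xi>)\<^sup>2"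
      using ae
    proof eventually_elim
      case (elim \<xi>)
      let ?p = "phase \<beta> \<eta> t \<xi> * g \<xi>"
      have "(cmod (u t \<xi>))\<^sup>2 = (cmod (?p + (u t \<xi> - ?p)))\<^sup>2" by simp
      also have "\<dots> \<le> 2 * (cmod ?p)\<^sup>2 + 2 * (cmod (u t \<xi> - ?p))\<^sup>2"
        using cmod_add_sq_le[of 1 ?p "u t \<xi> - ?p"] by simp
      also have "cmod ?p \<le> ?A * cmod (g \<xi>)"
        using cmod_phase_le_exp[OF \<eta>, of t T \<beta> \<xi>] t by (simp add: norm_mult mult_right_mono)
      then have "(cmod ?p)\<^sup>2 \<le> (?A * cmod (g \<xi>))\<^sup>2" by (intro power_mono) auto
      also have "(cmod (u t \<xi> - ?p))\<^sup>2 \<le> (K * B * duhamel_weight \<xi>)\<^sup>2" by (intro power_mono elim) auto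
      finally show ?case by (simp add: power_mult_distrib algebra_simps)
    qed
  qed
  also have "\<dots> = 2 * ?A\<^sup>2 * (hs_norm 0 g)\<^sup>2 + 2 * K\<^sup>2 * B\<^sup>2 * (LINT \<xi>|lborel. (duhamel_weight \<xi>)\<^sup>2)"
    unfolding hs_norm0_sq
    by (subst Bochner_Integration.integral_add)
       (auto simp del: mult_cancel_left intro!: integrable_mult_right integrable_Hs0 g integrable_duhamel_weight_sq)
  finally show ?thesis unfolding K_def[symmetric] by (simp add: mult_ac)
qed

text \<open>Bootstrap: at the first time at which the level \<open>B\<close> is reached, the quadratic estimate
  would give a value below \<open>B\<close>.\<close>
lemma mild_sol_small:
  assumes \<eta>: "\<eta> > 0" and g: "g \<in> Hs 0" and u: "u \<in> CHs 0 T" and sol: "mild_sol \<beta> \<eta> T g u"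
    and t: "t \<in> {0..T}" and gB: "(hs_norm 0 g)\<^sup>2 < B"
    and B: "2 * (exp (\<eta> * T))\<^sup>2 * (hs_norm 0 g)\<^sup>2
    + 2 * (exp (\<eta> * T) / (2 * pi * \<eta>))\<^sup>2 * (LINT \<xi>|lborel. (duhamel_weight \<xi>)\<^sup>2) * B\<^sup>2 < B"
  shows "(hs_norm 0 (u t))\<^sup>2 < B"
proof (rule ccontr)
  assume neg: "\<not> ?thesis"
  define X where "X t = (hs_norm 0 (u t))\<^sup>2" for t
  have cont: "continuous_on {0..T} X"
    unfolding X_def by (intro continuous_intros continuous_on_hs_norm u)
  have T: "T \<ge> 0" using t by auto
  have X0: "X 0 < B"
  proof -
    have "X 0 = (hs_norm 0 g)\<^sup>2"
      unfolding X_def hs_norm0_sq using mild_sol_initial[OF T sol]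
      by (intro integral_cong_AE)
        (use CHs_in_Hs[OF u, of 0] T g in \<open>auto dest!: borel_measurable_Hs elim: AE_mp\<close>)
    then show ?thesis using gB by simp
  qed
  define S where "S = {0..T} \<inter> X -` {B..}"
  have S: "closed S" "S \<noteq> {}" "bdd_below S"
  proof -
    show "closed S" unfolding S_def by (intro continuous_closed_preimage cont) auto
    show "S \<noteq> {}" using neg t by (auto simp: S_def X_def)
    show "bdd_below S" by (auto simp: S_def)
  qed
  define t0 where "t0 = Inf S"
  have t0: "t0 \<in> S" unfolding t0_def by (rule closed_contains_Inf[OF S(2,3,1)])
  then have t0T: "t0 \<in> {0..T}" and Xt0: "X t0 \<ge> B" by (auto simp: S_def)
  have before: "X t' < B" if "t' \<in> {0..<t0}" for t'
    using cInf_lower[OF _ S(3), of t'] that t0T by (force simp: S_def t0_def)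
  \<comment> \<open>The quadratic estimate needs the bound on the closed interval up to t0. By
    continuity the level B is attained at some time up to t0, and strictly earlier times are
    excluded.\<close>
  have "X t0 \<le> B"
  proof -
    have "\<exists>x\<ge>0. x \<le> t0 \<and> X x = B"
      by (rule IVT') (use X0 Xt0 t0T in \<open>auto intro: continuous_on_subset[OF cont]\<close>)
    then obtain x where "0 \<le> x" "x \<le> t0" "X x = B" by blast
    with before[of x] show ?thesis by (cases "x = t0") auto
  qed
  with before have "X t' \<le> B" if "t' \<in> {0..t0}" for t'
    using that by (cases "t' = t0") (auto simp: less_eq_real_def)
  from mild_sol_norm_le[OF \<eta> g u sol t0T this[unfolded X_def]] B Xt0
  show False unfolding X_def by linarith
qed

text \<open>The bootstrap runs at the level B = 2 a \<gamma>^2 H. The linear part takes at most half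
  of it, and the quadratic part b B^2 less than the other half once 4 a b H \<gamma>^2 < 1.
  Inserting this B into the pointwise bound makes the deviation from the linear evolution
  O(\<gamma>^2).\<close>

lemma mild_sol_first_order:
  assumes \<eta>: "\<eta> > 0" and h: "h \<in> Hs 0"
  obtains K \<gamma>0 where "K \<ge> 0" "\<gamma>0 > 0" "\<gamma>0 \<le> 1"
    "\<And>\<gamma> u t. \<lbrakk>0 < \<gamma>; \<gamma> < \<gamma>0; u \<in> CHs 0 T; mild_sol \<beta> \<eta> T (scaleX \<gamma> h) u; t \<in> {0..T}\<rbrakk> \<Longrightarrow>
      AE \<xi> in lborel. cmod (u t \<xi> - phase \<beta> \<eta> t \<xi> * (of_real \<gamma> * h \<xi>)) \<le> K * \<gamma>\<^sup>2 * duhamel_weight \<xi>"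
proof -
  \<comment> \<open>The added 1 in H and in a keeps H positive and a at least 1, so the datum starts
    strictly below the level B even if h has norm zero.\<close>
  define H where "H = (hs_norm 0 h)\<^sup>2 + 1"
  define a where "a = 2 * (exp (\<eta> * T))\<^sup>2 + 1"
  define K0 where "K0 = exp (\<eta> * T) / (2 * pi * \<eta>)"
  define b where "b = 2 * K0\<^sup>2 * (LINT \<xi>|lborel. (duhamel_weight \<xi>)\<^sup>2)"
  have H: "H > 0" "(hs_norm 0 h)\<^sup>2 \<le> H" by (auto simp: H_def add_nonneg_pos)
  have a: "a \<ge> 1" by (simp add: a_def)
  have b: "b \<ge> 0" by (simp add: b_def)
  have K0: "K0 \<ge> 0" using \<eta> by (simp add: K0_def)
  \<comment> \<open>Since \<gamma> < 1 gives \<gamma>^2 \<le> \<gamma>, this threshold ensures 4 a b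
    H \<gamma>^2 < 1.\<close>
  define \<gamma>0 where "\<gamma>0 = 1 / (4 * a * b * H + 1)"
  have abH: "4 * a * b * H \<ge> 0" using a b H by simp
  show thesis
  proof (rule that)
    show "\<gamma>0 > 0" "\<gamma>0 \<le> 1" using abH unfolding \<gamma>0_def by (auto simp del: mult_le_0_iff zero_le_mult_iff simp: add_nonneg_pos divide_le_eq_1)
    show "K0 * 2 * a * H \<ge> 0" using K0 a H by simp
    fix \<gamma> u t
    assume \<gamma>: "0 < \<gamma>" "\<gamma> < \<gamma>0" and u: "u \<in> CHs 0 T" and sol: "mild_sol \<beta> \<eta> T (scaleX \<gamma> h) u" and t: "t \<in> {0..T}"
    define B where "B = 2 * a * \<gamma>\<^sup>2 * H"
    have gn: "(hs_norm 0 (scaleX \<gamma> h))\<^sup>2 \<le> \<gamma>\<^sup>2 * H"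
      unfolding hs_norm_scaleX power_mult_distrib power2_abs by (intro mult_left_mono H) auto
    have pos: "\<gamma>\<^sup>2 * H > 0" using \<gamma> H by simp
    have "\<gamma>\<^sup>2 * H < 2 * a * (\<gamma>\<^sup>2 * H)" using mult_strict_right_mono[of 1 "2 * a", OF _ pos] a by simp
    with gn have lt: "(hs_norm 0 (scaleX \<gamma> h))\<^sup>2 < B" by (simp add: B_def mult_ac)
    have "b * B\<^sup>2 < a * (\<gamma>\<^sup>2 * H)"
    proof -
      have "\<gamma> < 1" using \<gamma> \<open>\<gamma>0 \<le> 1\<close> by simp
      then have "\<gamma>\<^sup>2 \<le> \<gamma>" using \<gamma>(1) by (simp add: power2_eq_square mult_le_cancel_left1)
      have "4 * a * b * H * \<gamma>\<^sup>2 \<le> 4 * a * b * H * \<gamma>" using \<open>\<gamma>\<^sup>2 \<le> \<gamma>\<close> abH by (intro mult_left_mono)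
      also have "\<dots> < (4 * a * b * H + 1) * \<gamma>" using \<gamma> by (simp add: algebra_simps)
      also have "\<dots> < (4 * a * b * H + 1) * \<gamma>0" using \<gamma> by (intro mult_strict_left_mono add_nonneg_pos abH) auto
      also have "\<dots> = 1" using add_nonneg_pos[OF abH zero_less_one] unfolding \<gamma>0_def by (metis less_irrefl nonzero_mult_div_cancel_left times_divide_eq_right mult_1_right)
      finally have "(4 * a * b * H * \<gamma>\<^sup>2) * (a * (\<gamma>\<^sup>2 * H)) < 1 * (a * (\<gamma>\<^sup>2 * H))"
        using a pos by (intro mult_strict_right_mono) auto
      then show ?thesis by (simp add: B_def power2_eq_square mult_ac)
    qed
    moreover have "2 * (exp (\<eta> * T))\<^sup>2 * (hs_norm 0 (scaleX \<gamma> h))\<^sup>2 \<le> a * (\<gamma>\<^sup>2 * H)"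
      using a by (intro mult_mono gn) (auto simp: a_def)
    ultimately have lt': "2 * (exp (\<eta> * T))\<^sup>2 * (hs_norm 0 (scaleX \<gamma> h))\<^sup>2 + b * B\<^sup>2 < B"
      by (simp add: B_def)
    have "(hs_norm 0 (u t'))\<^sup>2 \<le> B" if "t' \<in> {0..t}" for t'
      using mild_sol_small[OF \<eta> scaleX_in_Hs[OF h] u sol _ lt lt'[unfolded b_def K0_def], of t'] that t by auto
    from mild_sol_pointwise[OF \<eta> u sol t this, folded K0_def]
    show "AE \<xi> in lborel. cmod (u t \<xi> - phase \<beta> \<eta> t \<xi> * (of_real \<gamma> * h \<xi>)) \<le> K0 * 2 * a * H * \<gamma>\<^sup>2 * duhamel_weight \<xi>"
      by (simp add: B_def scaleX_def mult_ac)
  qed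
qed

subsection \<open>The self-interaction of a frequency bump\<close>

text \<open>The band is symmetric because \<open>Hs\<close> demands conjugation symmetry.\<close>

definition bump :: "real \<Rightarrow> real \<Rightarrow> complex" where
  "bump N \<xi> = of_bool (N \<le> \<bar>\<xi>\<bar> \<and> \<bar>\<xi>\<bar> \<le> 2 * N)"

lemma borel_measurable_bump [measurable]: "bump N \<in> borel_measurable borel"
  unfolding bump_def[abs_def] of_bool_def by measurable

lemma integrable_bump_majorant:
  "integrable lborel (\<lambda>\<xi>::real. indicator {-2*N..-N} \<xi> + indicator {N..2*N} \<xi> :: real)"
  by (intro Bochner_Integration.integrable_add) (auto simp: integrable_indicator_iff emeasure_lborel_Icc_eq)

lemma integrable_cmod_bump: "integrable lborel (\<lambda>\<xi>. cmod (bump N \<xi>))"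
  by (rule Bochner_Integration.integrable_bound[OF integrable_bump_majorant[of N]])
    (auto simp: bump_def indicator_def)

text \<open>The support has length 2 N, and on it 1 + \<xi>^2 \<ge> N^2, so for s \<le> 0 the
  Sobolev weight is at most (N^2)^s.\<close>

lemma hs_bump:
  assumes N: "N > 0" and s: "s \<le> 0"
  shows "bump N \<in> Hs s" "(hs_norm s (bump N))\<^sup>2 \<le> 2 * N * (N\<^sup>2) powr s"
proof -
  let ?m = "\<lambda>\<xi>. (N\<^sup>2) powr s * (indicator {-2*N..-N} \<xi> + indicator {N..2*N} \<xi>)"
  have le: "(1 + \<xi>\<^sup>2) powr s * (cmod (bump N \<xi>))\<^sup>2 \<le> ?m \<xi>" for \<xi>
  proof (cases "N \<le> \<bar>\<xi>\<bar> \<and> \<bar>\<xi>\<bar> \<le> 2 * N")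
    case True
    then have "N\<^sup>2 \<le> \<bar>\<xi>\<bar>\<^sup>2" using N by (intro power_mono) auto
    then have "(1 + \<xi>\<^sup>2) powr s \<le> (N\<^sup>2) powr s"
      using N s by (intro powr_mono2') auto
    moreover have "indicator {-2*N..-N} \<xi> + indicator {N..2*N} \<xi> \<ge> (1::real)"
      using True by (auto simp: indicator_def abs_if split: if_splits)
    ultimately have "(1 + \<xi>\<^sup>2) powr s * 1 \<le> ?m \<xi>"
      by (intro mult_mono) auto
    then show ?thesis using True by (simp add: bump_def)
  qed (auto simp: bump_def)
  have int: "integrable lborel ?m" by (intro integrable_mult_right integrable_bump_majorant)
  have int2: "integrable lborel (\<lambda>\<xi>. (1 + \<xi>\<^sup>2) powr s * (cmod (bump N \<xi>))\<^sup>2)"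
  proof (rule Bochner_Integration.integrable_bound[OF int])
    have "norm ((1 + \<xi>\<^sup>2) powr s * (cmod (bump N \<xi>))\<^sup>2) \<le> norm (?m \<xi>)" for \<xi>
    proof -
      have "0 \<le> (1 + \<xi>\<^sup>2) powr s * (cmod (bump N \<xi>))\<^sup>2" by simp
      with le[of \<xi>] show ?thesis unfolding real_norm_def by linarith
    qed
    then show "AE \<xi> in lborel. norm ((1 + \<xi>\<^sup>2) powr s * (cmod (bump N \<xi>))\<^sup>2) \<le> norm (?m \<xi>)" by blast
  qed measurable
  then show "bump N \<in> Hs s"
    by (auto simp: Hs_def bump_def)
  have "(hs_norm s (bump N))\<^sup>2 \<le> integral\<^sup>L lborel ?m"
    unfolding hs_norm_sq by (intro integral_mono int int2 le)
  also have "\<dots> = (N\<^sup>2) powr s * (LINT \<xi>|lborel. indicator {-2*N..-N} \<xi> + indicator {N..2*N} \<xi>)"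
    by (rule integral_mult_right_zero)
  also have "(LINT \<xi>|lborel. indicator {-2*N..-N} \<xi> + indicator {N..2*N} \<xi>) = 2 * N"
    using N by (subst Bochner_Integration.integral_add) (auto simp: integrable_indicator_iff emeasure_lborel_Icc_eq)
  also have "(N\<^sup>2) powr s * (2 * N) = 2 * N * (N\<^sup>2) powr s" by simp
  finally show "(hs_norm s (bump N))\<^sup>2 \<le> 2 * N * (N\<^sup>2) powr s" .
qed

section \<open>Averaging over the frequency window\<close>

text \<open>Above 2 N, so the bump vanishes here; above N, so a sum of two band frequencies lands
  here only if both are positive; at least N / 2 above 2 N, so the set of such pairs has length at
  least N / 2; at most 3 N, so a summand that is at least N forces the other to be at most 2
  N.\<close>

definition window :: "real \<Rightarrow> real set" where
  "window N = {5 * N / 2..3 * N}"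

text \<open>The sign and the imaginary part undo the factor i in \<open>nonlin\<close> and the minus
  sign before the Duhamel integral, so that the leading term becomes positive.\<close>

definition window_functional :: "real \<Rightarrow> (real \<Rightarrow> complex) \<Rightarrow> real" where
  "window_functional N g = (LINT \<xi>|lborel. indicator (window N) \<xi> * (- Im (g \<xi>)))"

lemma window_sets [measurable]: "window N \<in> sets borel"
  by (simp add: window_def)

text \<open>Duality between H^s and H^(-s): the factor bounds the H^(-s) norm of the indicator of
  the window, which has length N / 2 and on which 1 + \<xi>^2 \<le> 1 + 9 N^2 \<le> 10 N^2.
  Cauchy-Schwarz is again replaced by weighted Young and optimisation in c.\<close>

lemma window_functional_bound:
  assumes N: "N \<ge> 1" and s: "s \<le> 0" and g: "g \<in> Hs s"
  shows "integrable lborel (\<lambda>\<xi>. indicator (window N) \<xi> * (- Im (g \<xi>)))" (is ?int)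
    and "\<bar>window_functional N g\<bar> \<le> sqrt (N / 2) * sqrt ((10 * N\<^sup>2) powr (- s)) * hs_norm s g" (is ?le)
proof -
  note [measurable] = borel_measurable_Hs[OF g]
  let ?M = "(10 * N\<^sup>2) powr (- s)"
  let ?maj = "\<lambda>c \<xi>. c / 2 * indicator (window N) \<xi> + ?M / (2 * c) * ((1 + \<xi>\<^sup>2) powr s * (cmod (g \<xi>))\<^sup>2)"
  have w: "integrable lborel (indicator (window N) :: real \<Rightarrow> real)"
    by (auto simp: window_def integrable_indicator_iff emeasure_lborel_Icc_eq)
  have maj: "integrable lborel (?maj c)" for c
    by (intro Bochner_Integration.integrable_add integrable_mult_right w integrable_Hs g)
  have le: "\<bar>indicator (window N) \<xi> * (- Im (g \<xi>))\<bar> \<le> ?maj c \<xi>" if c: "c > 0" for c \<xi>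
  proof (cases "\<xi> \<in> window N")
    case True
    then have "\<xi>\<^sup>2 \<le> (3 * N)\<^sup>2" using N by (intro power_mono) (auto simp: window_def)
    moreover have "1 \<le> N\<^sup>2" using N by simp
    ultimately have "1 + \<xi>\<^sup>2 \<le> 10 * N\<^sup>2" by (simp add: power_mult_distrib)
    then have "(10 * N\<^sup>2) powr s \<le> (1 + \<xi>\<^sup>2) powr s" using s by (intro powr_mono2') auto
    then have "?M * (10 * N\<^sup>2) powr s * (cmod (g \<xi>))\<^sup>2 \<le> ?M * (1 + \<xi>\<^sup>2) powr s * (cmod (g \<xi>))\<^sup>2"
      by (intro mult_right_mono mult_left_mono) auto
    moreover have "?M * (10 * N\<^sup>2) powr s = 1" using N by (simp add: powr_add[symmetric])
    ultimately have g2: "(cmod (g \<xi>))\<^sup>2 \<le> ?M * (1 + \<xi>\<^sup>2) powr s * (cmod (g \<xi>))\<^sup>2" by simp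
    have "0 \<le> (c - cmod (g \<xi>))\<^sup>2" by simp
    then have "cmod (g \<xi>) * (2 * c) \<le> c\<^sup>2 + (cmod (g \<xi>))\<^sup>2" by (simp add: power2_eq_square algebra_simps)
    then have "cmod (g \<xi>) \<le> (c\<^sup>2 + (cmod (g \<xi>))\<^sup>2) / (2 * c)" using c by (simp add: pos_le_divide_eq)
    also have "\<dots> = c / 2 + (cmod (g \<xi>))\<^sup>2 / (2 * c)" using c by (simp add: power2_eq_square add_divide_distrib)
    also have "\<dots> \<le> c / 2 + (?M * (1 + \<xi>\<^sup>2) powr s * (cmod (g \<xi>))\<^sup>2) / (2 * c)"
      using c g2 by (intro add_left_mono divide_right_mono) auto
    finally show ?thesis using True abs_Im_le_cmod[of "g \<xi>"] by simp
  qed (use c in auto)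
  show ?int
  proof (rule Bochner_Integration.integrable_bound[OF maj[of 1]])
    have "norm (indicator (window N) \<xi> * (- Im (g \<xi>))) \<le> norm (?maj 1 \<xi>)" for \<xi>
      unfolding real_norm_def by (rule order_trans[OF le[of 1] abs_ge_self]) simp
    then show "AE \<xi> in lborel. norm (indicator (window N) \<xi> * (- Im (g \<xi>))) \<le> norm (?maj 1 \<xi>)" by blast
  qed measurable
  have wm: "(LINT \<xi>|lborel. indicator (window N) \<xi>) = N / 2"
    using N by (simp add: window_def)
  have "2 * \<bar>window_functional N g\<bar> \<le> 2 * sqrt (N / 2) * (sqrt ?M * hs_norm s g)"
  proof (rule le_two_mult_of_weighted)
    fix c :: real assume c: "c > 0"
    have "\<bar>window_functional N g\<bar> \<le> (LINT \<xi>|lborel. ?maj c \<xi>)"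
      unfolding window_functional_def by (intro integral_abs_bound_integral \<open>?int\<close> maj le c)
    also have "\<dots> = c / 2 * (N / 2) + ?M / (2 * c) * (hs_norm s g)\<^sup>2"
      using w integrable_Hs[OF g] wm unfolding hs_norm_sq by simp
    finally show "2 * \<bar>window_functional N g\<bar> \<le> c * (sqrt (N / 2))\<^sup>2 + (sqrt ?M * hs_norm s g)\<^sup>2 / c"
      using N by (simp add: power_mult_distrib field_simps)
  qed (use N in auto)
  then show ?le by (simp add: mult_ac)
qed

lemma bounded_functional_window:
  assumes N: "N \<ge> 1" and s: "s \<le> 0"
  shows "bounded_functional s (sqrt (N / 2) * sqrt ((10 * N\<^sup>2) powr (- s))) (window_functional N)"
  unfolding bounded_functional_def
proof (intro conjI ballI allI)
  fix g k a assume g: "g \<in> Hs s"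
  show "window_functional N (\<lambda>\<xi>. complex_of_real a * g \<xi>) = a * window_functional N g"
    unfolding window_functional_def by (subst integral_mult_right_zero[symmetric]) (simp add: mult_ac)
  show "\<bar>window_functional N g\<bar> \<le> sqrt (N / 2) * sqrt ((10 * N\<^sup>2) powr (- s)) * hs_norm s g"
    by (rule window_functional_bound[OF N s g])
  assume k: "k \<in> Hs s"
  show "window_functional N (\<lambda>\<xi>. g \<xi> + k \<xi>) = window_functional N g + window_functional N k"
    using Bochner_Integration.integral_add[OF window_functional_bound(1)[OF N s g] window_functional_bound(1)[OF N s k]]
    unfolding window_functional_def by (simp add: algebra_simps)
qed

section \<open>Lower bound for the interaction on the window\<close>

lemma Re_exp_ge_half:
  assumes "- 1 / 4 \<le> Re z" "\<bar>Im z\<bar> \<le> 1 / 4"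
  shows "1 / 2 \<le> Re (exp z)"
proof -
  have e: "3 / 4 \<le> exp (Re z)" using exp_ge_add_one_self[of "Re z"] assms(1) by linarith
  have "\<bar>sin (Im z / 2)\<bar> \<le> 1 / 8" using abs_sin_x_le_abs_x[of "Im z / 2"] assms(2) by simp
  then have "\<bar>sin (Im z / 2)\<bar>\<^sup>2 \<le> (1 / 8)\<^sup>2" by (intro power_mono) auto
  then have c: "2 / 3 \<le> cos (Im z)"
    using cos_double_sin[of "Im z / 2"] by (simp add: power2_eq_square)
  have "(3 / 4) * (2 / 3) \<le> exp (Re z) * cos (Im z)" by (intro mult_mono e c) auto
  then show ?thesis by (simp add: Re_exp)
qed

text \<open>For positive frequencies the three dispersive exponents add up to \<beta> S and the
  dissipative ones to - \<eta> S plus a nonnegative term. Since x^2 + y^2 \<le> (x + y)^2 \<le> 9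
  N^2, one gets S \<le> 9 N^2 t, and 36 = 4 * 9 makes both \<beta> S and \<eta> S at most 1 /
  4.\<close>

lemma Re_phase_product_ge_half:
  assumes pos: "\<beta> > 0" "\<eta> > 0" and N: "N \<ge> 1" and t: "0 \<le> t'" "t' \<le> t" "36 * (\<beta> + \<eta>) * N\<^sup>2 * t \<le> 1"
    and \<xi>: "N \<le> x" "x \<le> 2 * N" "N \<le> y" "y \<le> 2 * N" "x + y \<le> 3 * N"
  shows "1 / 2 \<le> Re (phase \<beta> \<eta> (t - t') (x + y) * phase \<beta> \<eta> t' x * phase \<beta> \<eta> t' y)"
proof -
  define S where "S = (x + y)\<^sup>2 * (t - t') + x\<^sup>2 * t' + y\<^sup>2 * t'"
  have S: "0 \<le> S" "S \<le> 9 * N\<^sup>2 * t"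
  proof -
    show "0 \<le> S" using t by (simp add: S_def)
    have "x\<^sup>2 + y\<^sup>2 \<le> (x + y)\<^sup>2" using N \<xi> by (simp add: power2_sum)
    then have "(x\<^sup>2 + y\<^sup>2) * t' \<le> (x + y)\<^sup>2 * t'" using t by (intro mult_right_mono)
    then have "S \<le> (x + y)\<^sup>2 * t" by (simp add: S_def algebra_simps)
    also have "(x + y)\<^sup>2 \<le> (3 * N)\<^sup>2" using N \<xi> by (intro power_mono) auto
    then have "(x + y)\<^sup>2 * t \<le> (3 * N)\<^sup>2 * t" using t by (intro mult_right_mono) auto
    finally show "S \<le> 9 * N\<^sup>2 * t" by (simp add: power_mult_distrib)
  qed
  have N2t: "0 \<le> N\<^sup>2 * t" using t by simp
  have tot: "36 * (\<beta> * (N\<^sup>2 * t)) + 36 * (\<eta> * (N\<^sup>2 * t)) \<le> 1" using t(3) by (simp add: algebra_simps)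
  have nn: "0 \<le> \<beta> * (N\<^sup>2 * t)" "0 \<le> \<eta> * (N\<^sup>2 * t)" using N2t pos by auto
  have "\<beta> * S \<le> \<beta> * (9 * N\<^sup>2 * t)" using S(2) pos by (intro mult_left_mono) auto
  also have "\<dots> = 9 * (\<beta> * (N\<^sup>2 * t))" by simp
  finally have \<beta>S: "\<beta> * S \<le> 1 / 4" using tot nn by linarith
  have "\<eta> * S \<le> \<eta> * (9 * N\<^sup>2 * t)" using S(2) pos by (intro mult_left_mono) auto
  also have "\<dots> = 9 * (\<eta> * (N\<^sup>2 * t))" by simp
  finally have \<eta>S: "\<eta> * S \<le> 1 / 4" using tot nn by linarith
  define z where "z = Complex (- \<eta> * ((x + y)\<^sup>2 - \<bar>x + y\<bar>) * (t - t')) (\<beta> * (x + y) * \<bar>x + y\<bar> * (t - t'))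
    + Complex (- \<eta> * (x\<^sup>2 - \<bar>x\<bar>) * t') (\<beta> * x * \<bar>x\<bar> * t') + Complex (- \<eta> * (y\<^sup>2 - \<bar>y\<bar>) * t') (\<beta> * y * \<bar>y\<bar> * t')"
  have "Re z = - (\<eta> * S) + \<eta> * (\<bar>x + y\<bar> * (t - t') + \<bar>x\<bar> * t' + \<bar>y\<bar> * t')"
    by (simp add: z_def S_def algebra_simps)
  moreover have "0 \<le> \<eta> * (\<bar>x + y\<bar> * (t - t') + \<bar>x\<bar> * t' + \<bar>y\<bar> * t')" using pos t by simp
  ultimately have "- 1 / 4 \<le> Re z" using \<eta>S by linarith
  moreover have "Im z = \<beta> * S"
    using N \<xi> by (simp add: z_def S_def algebra_simps power2_eq_square)
  then have "\<bar>Im z\<bar> \<le> 1 / 4" using \<beta>S S(1) pos by (simp add: abs_mult)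
  ultimately have "1 / 2 \<le> Re (exp z)" by (rule Re_exp_ge_half)
  then show ?thesis by (simp add: z_def phase_def exp_add)
qed

lemma AE_reflect:
  assumes "AE \<zeta> in lborel. P \<zeta>"
  shows "AE \<zeta> in lborel. P (\<xi> - \<zeta> :: real)"
proof -
  obtain Z where Z: "{x. \<not> P x} \<subseteq> Z" "Z \<in> null_sets lborel"
    using assms by (auto simp: eventually_ae_filter)
  have [measurable]: "Z \<in> sets borel" using Z by auto
  have "AE \<zeta> in lborel. \<zeta> \<notin> Z" using Z(2) by (rule AE_not_in)
  then have "AE \<zeta> in lborel. \<xi> + (-1) * \<zeta> \<notin> Z" by (rule AE_borel_affine[rotated 2]) auto
  then show ?thesis by eventually_elim (use Z(1) in auto)
qed

text \<open>Write v = m + r with m the linear evolution of the datum and r = O(\<gamma>^2). The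
  product of the two m terms has real part at least \<gamma>^2 / 2 on an interval of length at least
  N / 2, hence the \<gamma>^2 N / 4. The other three products are of order \<gamma>^3 and are
  dominated by an integrable function and its reflection, hence the factor 2.\<close>

lemma window_convolution_lower_bound:
  assumes pos: "\<beta> > 0" "\<eta> > 0" and N: "N \<ge> 1"
    and t: "0 \<le> t'" "t' \<le> t" "t \<le> T" "36 * (\<beta> + \<eta>) * N\<^sup>2 * t \<le> 1"
    and \<gamma>: "0 < \<gamma>" "\<gamma> \<le> 1" and K: "K \<ge> 0" and v: "v \<in> Hs 0" and \<xi>: "\<xi> \<in> window N"
    and ae: "AE \<zeta> in lborel. cmod (v \<zeta> - phase \<beta> \<eta> t' \<zeta> * (of_real \<gamma> * bump N \<zeta>)) \<le> K * \<gamma>\<^sup>2 * duhamel_weight \<zeta>"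
  shows "Re (phase \<beta> \<eta> (t - t') \<xi> * (LINT \<zeta>|lborel. v (\<xi> - \<zeta>) * v \<zeta>)) \<ge>
    \<gamma>\<^sup>2 * N / 4 - 2 * \<gamma> ^ 3 * ((exp (\<eta> * T))\<^sup>2 * (K + K\<^sup>2)) * (LINT \<zeta>|lborel. cmod (bump N \<zeta>) + (duhamel_weight \<zeta>)\<^sup>2)"
proof -
  define A where "A = exp (\<eta> * T)"
  have A: "A \<ge> 1" using pos t by (simp add: A_def)
  define M where "M = A\<^sup>2 * (K + K\<^sup>2)"
  have M: "M \<ge> 0" using K by (simp add: M_def)
  \<comment> \<open>The bump is its own square, so Q is a sum of squares and dominates all mixed
    products by the arithmetic-geometric mean inequality.\<close>
  define Q where "Q \<zeta> = cmod (bump N \<zeta>) + (duhamel_weight \<zeta>)\<^sup>2" for \<zeta>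
  have Q: "integrable lborel Q" unfolding Q_def[abs_def]
    by (intro Bochner_Integration.integrable_add integrable_cmod_bump integrable_duhamel_weight_sq)
  have Q': "integrable lborel (\<lambda>\<zeta>. Q (\<xi> - \<zeta>))"
    using lborel_integrable_real_affine[OF Q, of "-1" \<xi>] by simp
  have Qint: "(LINT \<zeta>|lborel. Q (\<xi> - \<zeta>)) = integral\<^sup>L lborel Q"
    using lborel_integral_real_affine[of "-1" Q \<xi>] by simp
  let ?q = "phase \<beta> \<eta> (t - t') \<xi>" and ?p = "phase \<beta> \<eta> t'" and ?b = "\<lambda>\<zeta>. cmod (bump N \<zeta>)"
  have q: "cmod ?q \<le> A" unfolding A_def by (rule cmod_phase_le_exp) (use pos t in auto)
  have p: "cmod (?p x) \<le> A" for x unfolding A_def by (rule cmod_phase_le_exp) (use pos t in auto)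
  have b: "bump N x = of_real (?b x)" "(?b x)\<^sup>2 = ?b x" "?b x \<ge> 0" for x by (auto simp: bump_def)
  \<comment> \<open>On this interval both \<zeta> and \<xi> - \<zeta> are at least N, and then at
    most 2 N because \<xi> \<le> 3 N.\<close>
  define I :: "real \<Rightarrow> real" where "I \<zeta> = indicator {N..\<xi> - N} \<zeta>" for \<zeta>
  have I: "integrable lborel I" unfolding I_def[abs_def] by (auto simp: integrable_indicator_iff emeasure_lborel_Icc_eq)
  have main: "\<gamma>\<^sup>2 / 2 * I \<zeta> \<le> Re (?q * (?p x * (of_real \<gamma> * bump N x)) * (?p \<zeta> * (of_real \<gamma> * bump N \<zeta>)))"
    if x: "x = \<xi> - \<zeta>" for \<zeta> x
  proof -
    have Re: "Re (of_real a * z) = a * Re z" for a z by simp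
    have *: "Re (?q * (?p x * (of_real \<gamma> * bump N x)) * (?p \<zeta> * (of_real \<gamma> * bump N \<zeta>)))
        = \<gamma>\<^sup>2 * (?b x * ?b \<zeta>) * Re (?q * ?p x * ?p \<zeta>)"
    proof -
      have "?q * (?p x * (of_real \<gamma> * bump N x)) * (?p \<zeta> * (of_real \<gamma> * bump N \<zeta>))
        = of_real (\<gamma>\<^sup>2 * (?b x * ?b \<zeta>)) * (?q * ?p x * ?p \<zeta>)"
        by (subst (1 2) b(1)) (simp add: power2_eq_square mult_ac)
      then show ?thesis by (simp only: Re)
    qed
    show ?thesis
    proof (cases "N \<le> \<bar>x\<bar> \<and> \<bar>x\<bar> \<le> 2 * N \<and> N \<le> \<bar>\<zeta>\<bar> \<and> \<bar>\<zeta>\<bar> \<le> 2 * N")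
      case True
      \<comment> \<open>A negative summand is at most -N and would push the sum to at most N, below
        the window.\<close>
      with \<xi> x N have r: "N \<le> x" "x \<le> 2 * N" "N \<le> \<zeta>" "\<zeta> \<le> 2 * N" "x + \<zeta> \<le> 3 * N" "x + \<zeta> = \<xi>"
        by (auto simp: window_def abs_if split: if_splits)
      have "1 / 2 \<le> Re (?q * ?p x * ?p \<zeta>)"
        using Re_phase_product_ge_half[OF pos N t(1,2,4) r(1-5)] r(6) by simp
      then have "\<gamma>\<^sup>2 * (1 / 2) \<le> \<gamma>\<^sup>2 * Re (?q * ?p x * ?p \<zeta>)" by (intro mult_left_mono) auto
      moreover have "\<gamma>\<^sup>2 / 2 * I \<zeta> \<le> \<gamma>\<^sup>2 * (1 / 2)" by (auto simp: I_def indicator_def)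
      moreover have "?b x = 1" "?b \<zeta> = 1" using True by (auto simp: bump_def)
      ultimately show ?thesis unfolding * by simp
    next
      case False
      then have "?b x * ?b \<zeta> = 0" by (auto simp: bump_def)
      moreover have "I \<zeta> = 0" using False \<xi> x N by (auto simp: I_def window_def indicator_def)
      ultimately show ?thesis unfolding * by (simp only: mult_zero_left mult_zero_right order_refl)
    qed
  qed
  have point: "\<gamma>\<^sup>2 / 2 * I \<zeta> - \<gamma> ^ 3 * M * (Q (\<xi> - \<zeta>) + Q \<zeta>) \<le> Re (?q * (v (\<xi> - \<zeta>) * v \<zeta>))"
    if r\<zeta>: "cmod (v \<zeta> - ?p \<zeta> * (of_real \<gamma> * bump N \<zeta>)) \<le> K * \<gamma>\<^sup>2 * duhamel_weight \<zeta>"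
      and rx: "cmod (v (\<xi> - \<zeta>) - ?p (\<xi> - \<zeta>) * (of_real \<gamma> * bump N (\<xi> - \<zeta>))) \<le> K * \<gamma>\<^sup>2 * duhamel_weight (\<xi> - \<zeta>)" for \<zeta>
  proof -
    define x where "x = \<xi> - \<zeta>"
    define m where "m y = ?p y * (of_real \<gamma> * bump N y)" for y
    define r where "r y = v y - m y" for y
    have m: "cmod (m y) \<le> A * \<gamma> * ?b y" for y
      using mult_right_mono[OF p[of y], of "\<gamma> * ?b y"] \<gamma> by (simp add: m_def norm_mult mult_ac)
    have r1: "cmod (r \<zeta>) \<le> K * \<gamma>\<^sup>2 * duhamel_weight \<zeta>" "cmod (r x) \<le> K * \<gamma>\<^sup>2 * duhamel_weight x"
      using r\<zeta> rx by (auto simp: r_def m_def x_def)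
    have eq: "?q * (v x * v \<zeta>) = ?q * m x * m \<zeta> + ?q * (m x * r \<zeta> + r x * m \<zeta> + r x * r \<zeta>)"
      by (simp add: r_def algebra_simps)
    have e1: "cmod (m x * r \<zeta>) \<le> (A * \<gamma> * ?b x) * (K * \<gamma>\<^sup>2 * duhamel_weight \<zeta>)"
      unfolding norm_mult using A \<gamma> by (intro mult_mono m r1) auto
    have e2: "cmod (r x * m \<zeta>) \<le> (K * \<gamma>\<^sup>2 * duhamel_weight x) * (A * \<gamma> * ?b \<zeta>)"
      unfolding norm_mult using K by (intro mult_mono m r1) auto
    have e3: "cmod (r x * r \<zeta>) \<le> (K * \<gamma>\<^sup>2 * duhamel_weight x) * (K * \<gamma>\<^sup>2 * duhamel_weight \<zeta>)"
      unfolding norm_mult using K by (intro mult_mono r1) auto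
    have am: "c * d \<le> (c\<^sup>2 + d\<^sup>2) / 2" for c d :: real using sum_squares_bound[of c d] by simp
    have "cmod (?q * (m x * r \<zeta> + r x * m \<zeta> + r x * r \<zeta>)) \<le> A * cmod (m x * r \<zeta> + r x * m \<zeta> + r x * r \<zeta>)"
      unfolding norm_mult by (intro mult_right_mono q) auto
    also have "\<dots> \<le> A * (cmod (m x * r \<zeta>) + cmod (r x * m \<zeta>) + cmod (r x * r \<zeta>))"
      using A by (intro mult_left_mono order_trans[OF norm_triangle_ineq] add_right_mono norm_triangle_ineq) auto
    also have "\<dots> \<le> A * ((A * \<gamma> * ?b x) * (K * \<gamma>\<^sup>2 * duhamel_weight \<zeta>) + (K * \<gamma>\<^sup>2 * duhamel_weight x) * (A * \<gamma> * ?b \<zeta>) + (K * \<gamma>\<^sup>2 * duhamel_weight x) * (K * \<gamma>\<^sup>2 * duhamel_weight \<zeta>))"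
      using A by (intro mult_left_mono add_mono e1 e2 e3) auto
    also have "\<dots> = \<gamma> ^ 3 * (A\<^sup>2 * K) * (?b x * duhamel_weight \<zeta>) + \<gamma> ^ 3 * (A\<^sup>2 * K) * (duhamel_weight x * ?b \<zeta>) + \<gamma> ^ 4 * (A * K\<^sup>2) * (duhamel_weight x * duhamel_weight \<zeta>)"
      by (simp add: power2_eq_square power3_eq_cube power4_eq_xxxx algebra_simps)
    \<comment> \<open>Since \<gamma> \<le> 1, the quartic term counts as cubic, and A \<ge> 1 lets M
      dominate all three coefficients.\<close>
    also have "\<dots> \<le> \<gamma> ^ 3 * M * (((?b x)\<^sup>2 + (duhamel_weight \<zeta>)\<^sup>2) / 2) + \<gamma> ^ 3 * M * (((duhamel_weight x)\<^sup>2 + (?b \<zeta>)\<^sup>2) / 2) + \<gamma> ^ 3 * M * (((duhamel_weight x)\<^sup>2 + (duhamel_weight \<zeta>)\<^sup>2) / 2)"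
    proof -
      have 1: "A\<^sup>2 * K \<le> M" using A K by (simp add: M_def mult_left_mono)
      have "A * K\<^sup>2 \<le> A\<^sup>2 * K\<^sup>2" using A by (intro mult_right_mono) (auto simp: power2_eq_square)
      also have "\<dots> \<le> M" using K by (simp add: M_def algebra_simps)
      finally have 2: "A * K\<^sup>2 \<le> M" .
      have 3: "\<gamma> ^ 4 \<le> \<gamma> ^ 3" using \<gamma> by (intro power_decreasing) auto
      show ?thesis using \<gamma> A K M by (intro add_mono mult_mono 1 2 3 am) auto
    qed
    also have "\<dots> \<le> \<gamma> ^ 3 * M * (Q x + Q \<zeta>)"
    proof -
      have "((?b x)\<^sup>2 + (duhamel_weight \<zeta>)\<^sup>2) / 2 + ((duhamel_weight x)\<^sup>2 + (?b \<zeta>)\<^sup>2) / 2 + ((duhamel_weight x)\<^sup>2 + (duhamel_weight \<zeta>)\<^sup>2) / 2 \<le> Q x + Q \<zeta>"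
        unfolding b(2) Q_def using b(3)[of x] b(3)[of \<zeta>] by (simp add: field_simps)
      then have "\<gamma> ^ 3 * M * (((?b x)\<^sup>2 + (duhamel_weight \<zeta>)\<^sup>2) / 2 + ((duhamel_weight x)\<^sup>2 + (?b \<zeta>)\<^sup>2) / 2 + ((duhamel_weight x)\<^sup>2 + (duhamel_weight \<zeta>)\<^sup>2) / 2) \<le> \<gamma> ^ 3 * M * (Q x + Q \<zeta>)"
        using \<gamma> M by (intro mult_left_mono) auto
      then show ?thesis by (simp only: distrib_left)
    qed
    finally have err: "cmod (?q * (m x * r \<zeta> + r x * m \<zeta> + r x * r \<zeta>)) \<le> \<gamma> ^ 3 * M * (Q x + Q \<zeta>)" .
    have "Re (?q * (v x * v \<zeta>)) = Re (?q * m x * m \<zeta>) + Re (?q * (m x * r \<zeta> + r x * m \<zeta> + r x * r \<zeta>))"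
      unfolding eq by (rule plus_complex.sel(1))
    moreover have "\<gamma>\<^sup>2 / 2 * I \<zeta> \<le> Re (?q * m x * m \<zeta>)" unfolding m_def by (rule main[OF x_def])
    moreover note abs_Re_le_cmod[of "?q * (m x * r \<zeta> + r x * m \<zeta> + r x * r \<zeta>)"]
    ultimately show ?thesis using err unfolding x_def[symmetric] by linarith
  qed
  have conv: "integrable lborel (\<lambda>\<zeta>. ?q * (v (\<xi> - \<zeta>) * v \<zeta>))"
    by (intro integrable_mult_right integrable_convolution v)
  have "(LINT \<zeta>|lborel. \<gamma>\<^sup>2 / 2 * I \<zeta> - \<gamma> ^ 3 * M * (Q (\<xi> - \<zeta>) + Q \<zeta>)) \<le> (LINT \<zeta>|lborel. Re (?q * (v (\<xi> - \<zeta>) * v \<zeta>)))"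
  proof (rule integral_mono_AE)
    show "integrable lborel (\<lambda>\<zeta>. \<gamma>\<^sup>2 / 2 * I \<zeta> - \<gamma> ^ 3 * M * (Q (\<xi> - \<zeta>) + Q \<zeta>))"
      by (intro Bochner_Integration.integrable_diff integrable_mult_right Bochner_Integration.integrable_add I Q Q')
    show "integrable lborel (\<lambda>\<zeta>. Re (?q * (v (\<xi> - \<zeta>) * v \<zeta>)))" using conv by (rule integrable_Re)
    show "AE \<zeta> in lborel. \<gamma>\<^sup>2 / 2 * I \<zeta> - \<gamma> ^ 3 * M * (Q (\<xi> - \<zeta>) + Q \<zeta>) \<le> Re (?q * (v (\<xi> - \<zeta>) * v \<zeta>))"
      using ae AE_reflect[OF ae, of \<xi>] by eventually_elim (rule point)
  qed
  also have "(LINT \<zeta>|lborel. Re (?q * (v (\<xi> - \<zeta>) * v \<zeta>))) = Re (?q * (LINT \<zeta>|lborel. v (\<xi> - \<zeta>) * v \<zeta>))"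
    using integral_Re[OF conv] by (simp only: integral_mult_right_zero)
  also have "(LINT \<zeta>|lborel. \<gamma>\<^sup>2 / 2 * I \<zeta> - \<gamma> ^ 3 * M * (Q (\<xi> - \<zeta>) + Q \<zeta>))
    = \<gamma>\<^sup>2 / 2 * (LINT \<zeta>|lborel. I \<zeta>) - \<gamma> ^ 3 * M * ((LINT \<zeta>|lborel. Q (\<xi> - \<zeta>)) + (LINT \<zeta>|lborel. Q \<zeta>))"
    using I Q Q' by simp
  also have "(LINT \<zeta>|lborel. I \<zeta>) = \<xi> - 2 * N"
    using \<xi> N by (simp add: I_def[abs_def] window_def)
  finally have *: "\<gamma>\<^sup>2 / 2 * (\<xi> - 2 * N) - \<gamma> ^ 3 * M * (2 * (LINT \<zeta>|lborel. Q \<zeta>)) \<le> Re (?q * (LINT \<zeta>|lborel. v (\<xi> - \<zeta>) * v \<zeta>))"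
    unfolding Qint by simp
  have "\<gamma>\<^sup>2 / 2 * (N / 2) \<le> \<gamma>\<^sup>2 / 2 * (\<xi> - 2 * N)"
    using \<xi> by (intro mult_left_mono) (auto simp: window_def)
  with * show ?thesis unfolding M_def A_def Q_def by (simp add: mult_ac)
qed

text \<open>On the window only the Duhamel integral is left. Its multiplier \<xi> / (4 pi) is at
  least 5 N / (8 pi); time contributes the factor t and the window its length N / 2.\<close>

lemma mild_sol_window_lower_bound:
  assumes pos: "\<beta> > 0" "\<eta> > 0" and N: "N \<ge> 1"
    and t: "t \<in> {0..T}" "36 * (\<beta> + \<eta>) * N\<^sup>2 * t \<le> 1"
    and u: "u \<in> CHs 0 T" and sol: "mild_sol \<beta> \<eta> T (scaleX \<gamma> (bump N)) u"
    and low: "\<And>t' \<xi>. t' \<in> {0..t} \<Longrightarrow> \<xi> \<in> window N \<Longrightarrow>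
       m \<le> Re (phase \<beta> \<eta> (t - t') \<xi> * (LINT \<zeta>|lborel. u t' (\<xi> - \<zeta>) * u t' \<zeta>))"
    and m: "m \<ge> 0"
  shows "5 * N\<^sup>2 * t * m / (16 * pi) \<le> window_functional N (u t)"
proof -
  have uH: "u t \<in> Hs 0" by (rule CHs_in_Hs[OF u t(1)])
  have ae: "AE \<xi> in lborel. \<xi> \<in> window N \<longrightarrow> t * (5 * N / (8 * pi)) * m \<le> - Im (u t \<xi>)"
  proof -
    have "AE \<xi> in lborel. set_integrable lborel {0..t} (\<lambda>t'. phase \<beta> \<eta> (t - t') \<xi> * nonlin (u t') \<xi>)
      \<and> u t \<xi> = phase \<beta> \<eta> t \<xi> * scaleX \<gamma> (bump N) \<xi>
        - set_lebesgue_integral lborel {0..t} (\<lambda>t'. phase \<beta> \<eta> (t - t') \<xi> * nonlin (u t') \<xi>)"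
      using sol t unfolding mild_sol_def by (auto elim: AE_mp)
    then show ?thesis
    proof (rule AE_mp, intro AE_I2 impI, elim conjE)
      fix \<xi>
      have Im: "Im (of_real a * (\<i> * z)) = a * Re z" for a z by simp
      let ?f = "\<lambda>t'. phase \<beta> \<eta> (t - t') \<xi> * nonlin (u t') \<xi>"
      assume int: "set_integrable lborel {0..t} ?f"
        and eq: "u t \<xi> = phase \<beta> \<eta> t \<xi> * scaleX \<gamma> (bump N) \<xi> - set_lebesgue_integral lborel {0..t} ?f"
        and \<xi>: "\<xi> \<in> window N"
      have "bump N \<xi> = 0" using \<xi> N by (auto simp: window_def bump_def)
      then have "- Im (u t \<xi>) = Im (set_lebesgue_integral lborel {0..t} ?f)"
        unfolding eq by (simp add: scaleX_def)
      also have "\<dots> = (LINT t':{0..t}|lborel. Im (?f t'))"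
        using integral_Im[OF int[unfolded set_integrable_def]] by (simp add: set_lebesgue_integral_def)
      also have "\<dots> \<ge> (LINT t':{0..t}|lborel. 5 * N / (8 * pi) * m)"
      proof (rule set_integral_mono)
        show "set_integrable lborel {0..t} (\<lambda>t'. 5 * N / (8 * pi) * m)"
          by (rule borel_integrable_atLeastAtMost') simp
        show "set_integrable lborel {0..t} (\<lambda>t'. Im (?f t'))"
          using integrable_Im[OF int[unfolded set_integrable_def]] by (simp add: set_integrable_def)
        fix t' assume t': "t' \<in> {0..t}"
        let ?c = "LINT \<zeta>|lborel. u t' (\<xi> - \<zeta>) * u t' \<zeta>"
        have "?f t' = of_real (\<xi> / (4 * pi)) * (\<i> * (phase \<beta> \<eta> (t - t') \<xi> * ?c))"
          unfolding nonlin_def by (simp add: mult_ac)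
        then have "Im (?f t') = \<xi> / (4 * pi) * Re (phase \<beta> \<eta> (t - t') \<xi> * ?c)"
          by (simp only: Im)
        moreover have "5 * N / (8 * pi) * m \<le> \<xi> / (4 * pi) * Re (phase \<beta> \<eta> (t - t') \<xi> * ?c)"
        proof (intro mult_mono low[OF t' \<xi>] m)
          have "5 * N / (8 * pi) = (5 * N / 2) / (4 * pi)" by simp
          also have "\<dots> \<le> \<xi> / (4 * pi)" using \<xi> by (intro divide_right_mono) (auto simp: window_def)
          finally show "5 * N / (8 * pi) \<le> \<xi> / (4 * pi)" .
          show "0 \<le> \<xi> / (4 * pi)" using \<xi> N by (auto simp: window_def)
        qed
        ultimately show "5 * N / (8 * pi) * m \<le> Im (?f t')" by simp
      qed
      also have "(LINT t':{0..t}|lborel. 5 * N / (8 * pi) * m) = t * (5 * N / (8 * pi)) * m"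
        using t(1) by (simp add: set_lebesgue_integral_def)
      finally show "t * (5 * N / (8 * pi)) * m \<le> - Im (u t \<xi>)" .
    qed
  qed
  have w: "integrable lborel (indicator (window N) :: real \<Rightarrow> real)"
    by (auto simp: window_def integrable_indicator_iff emeasure_lborel_Icc_eq)
  have half: "(LINT \<xi>|lborel. indicator (window N) \<xi>) = N / 2"
    using N by (simp add: window_def)
  have "5 * N\<^sup>2 * t * m / (16 * pi) = (LINT \<xi>|lborel. indicator (window N) \<xi> * (t * (5 * N / (8 * pi)) * m))"
    unfolding integral_mult_left_zero half by (simp add: power2_eq_square)
  also have "\<dots> \<le> window_functional N (u t)"
    unfolding window_functional_def
  proof (rule integral_mono_AE)
    show "integrable lborel (\<lambda>\<xi>. indicator (window N) \<xi> * - Im (u t \<xi>))"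
      by (rule window_functional_bound(1)[OF N _ uH]) simp
    show "integrable lborel (\<lambda>\<xi>. indicator (window N) \<xi> * (t * (5 * N / (8 * pi)) * m))"
      by (intro integrable_mult_left w)
    show "AE \<xi> in lborel. indicator (window N) \<xi> * (t * (5 * N / (8 * pi)) * m) \<le> indicator (window N) \<xi> * - Im (u t \<xi>)"
      using ae by eventually_elim (auto simp: indicator_def)
  qed
  finally show ?thesis .
qed

text \<open>Supplies the a priori quadratic rate that \<open>quadratic_flow_bound\<close> asks
  for.\<close>

lemma window_functional_abs_le:
  assumes N: "N \<ge> 1" and g: "g \<in> Hs 0" and c: "c \<ge> 0"
    and ae: "AE \<xi> in lborel. \<xi> \<in> window N \<longrightarrow> cmod (g \<xi>) \<le> c"
  shows "\<bar>window_functional N g\<bar> \<le> N / 2 * c"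
proof -
  have int: "integrable lborel (\<lambda>\<xi>. indicator (window N) \<xi> * (- Im (g \<xi>)))"
    by (rule window_functional_bound(1)[OF N _ g]) simp
  have w: "integrable lborel (indicator (window N) :: real \<Rightarrow> real)"
    by (auto simp: window_def integrable_indicator_iff emeasure_lborel_Icc_eq)
  have half: "(LINT \<xi>|lborel. indicator (window N) \<xi>) = N / 2"
    using N by (simp add: window_def)
  have "\<bar>window_functional N g\<bar> \<le> (LINT \<xi>|lborel. \<bar>indicator (window N) \<xi> * (- Im (g \<xi>))\<bar>)"
    unfolding window_functional_def by (rule integral_abs_bound)
  also have "\<dots> \<le> (LINT \<xi>|lborel. indicator (window N) \<xi> * c)"
  proof (rule integral_mono_AE)
    show "integrable lborel (\<lambda>\<xi>. indicator (window N) \<xi> * c)"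
      by (intro integrable_mult_left w)
    show "AE \<xi> in lborel. \<bar>indicator (window N) \<xi> * (- Im (g \<xi>))\<bar> \<le> indicator (window N) \<xi> * c"
      using ae by eventually_elim (auto simp: indicator_def intro: order_trans[OF abs_Im_le_cmod])
  qed (use int in auto)
  finally show ?thesis unfolding integral_mult_left_zero half .
qed

section \<open>Upper against lower bound at frequency scale N\<close>

text \<open>Both bounds carry \<gamma>^2, which is cancelled; K, \<gamma>0 and the cubic remainder,
  whose dependence on N is uncontrolled, disappear with it. The number 128 is 16 * 8, where 1 / 8 is
  what the cubic error leaves of the leading 1 / 4.\<close>

lemma flow_inequality_at_scale:
  assumes pos: "\<beta> > 0" "\<eta> > 0" and s: "s \<le> 0" and N: "N \<ge> 1" and t: "t \<in> {0..T}" "36 * (\<beta> + \<eta>) * N\<^sup>2 * t \<le> 1"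
    and wp: "wp_C3_flow \<beta> \<eta> s T \<Phi>" and C: "C \<ge> 0"
    and second: "quadratic_flow_bound s T \<Phi> C"
  shows "5 * N ^ 3 * t / (128 * pi) \<le> sqrt (N / 2) * sqrt ((10 * N\<^sup>2) powr (- s)) * C * (2 * N * (N\<^sup>2) powr s)"
proof -
  let ?h = "bump N"
  define KN where "KN = sqrt (N / 2) * sqrt ((10 * N\<^sup>2) powr (- s))"
  have KN: "KN \<ge> 0" using N by (simp add: KN_def)
  have h: "?h \<in> Hs s" "(hs_norm s ?h)\<^sup>2 \<le> 2 * N * (N\<^sup>2) powr s" "?h \<in> Hs 0"
    using hs_bump[of N s] hs_bump(1)[of N 0] N s by auto
  have sol: "\<Phi> (scaleX \<gamma> ?h) \<in> CHs 0 T" "mild_sol \<beta> \<eta> T (scaleX \<gamma> ?h) (\<Phi> (scaleX \<gamma> ?h))" for \<gamma>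
    using wp scaleX_in_Hs[OF h(1)] scaleX_in_Hs[OF h(3)] unfolding wp_C3_flow_def by blast+
  obtain K \<gamma>0 where K: "K \<ge> 0" and \<gamma>0: "\<gamma>0 > 0" "\<gamma>0 \<le> 1"
    and ae: "\<And>\<gamma> u t. \<lbrakk>0 < \<gamma>; \<gamma> < \<gamma>0; u \<in> CHs 0 T; mild_sol \<beta> \<eta> T (scaleX \<gamma> ?h) u; t \<in> {0..T}\<rbrakk> \<Longrightarrow>
      AE \<xi> in lborel. cmod (u t \<xi> - phase \<beta> \<eta> t \<xi> * (of_real \<gamma> * ?h \<xi>)) \<le> K * \<gamma>\<^sup>2 * duhamel_weight \<xi>"
    using mild_sol_first_order[OF pos(2) h(3)] by blast
  have "\<bar>window_functional N (\<Phi> (scaleX \<gamma> ?h) t)\<bar> \<le> (N / 2 * K) * \<gamma>\<^sup>2" if \<gamma>: "0 < \<gamma>" "\<gamma> < \<gamma>0" for \<gamma>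
  proof -
    have "\<bar>window_functional N (\<Phi> (scaleX \<gamma> ?h) t)\<bar> \<le> N / 2 * (K * \<gamma>\<^sup>2)"
    proof (rule window_functional_abs_le[OF N CHs_in_Hs[OF sol(1) t(1)]])
      show "K * \<gamma>\<^sup>2 \<ge> 0" using K by simp
      have z: "?h \<xi> = 0" if "\<xi> \<in> window N" for \<xi> using that N by (auto simp: window_def bump_def)
      have "duhamel_weight \<xi> \<le> 1" for \<xi>
      proof (rule power2_le_imp_le)
        show "(duhamel_weight \<xi>)\<^sup>2 \<le> 1\<^sup>2" using duhamel_weight_sq_le[of \<xi>] by (rule order_trans) (simp add: divide_le_eq)
      qed simp
      then have le: "K * \<gamma>\<^sup>2 * duhamel_weight \<xi> \<le> K * \<gamma>\<^sup>2" for \<xi>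
        using K by (intro mult_left_le) auto
      show "AE \<xi> in lborel. \<xi> \<in> window N \<longrightarrow> cmod (\<Phi> (scaleX \<gamma> ?h) t \<xi>) \<le> K * \<gamma>\<^sup>2"
        using ae[OF \<gamma> sol t(1)]
      proof eventually_elim
        case (elim \<xi>)
        then show ?case using z[of \<xi>] le[of \<xi>] by (auto intro: order_trans)
      qed
    qed
    then show ?thesis by (simp add: mult_ac)
  qed
  from second[unfolded quadratic_flow_bound_def, rule_format,
      OF h(1) t(1) bounded_functional_window[OF N s, folded KN_def] KN \<gamma>0(1), OF this]
  obtain a0 where a0: "a0 > 0" and upper: "\<And>a. 0 < a \<Longrightarrow> a < a0 \<Longrightarrow>
      \<bar>window_functional N (\<Phi> (scaleX a ?h) t)\<bar> \<le> KN * C * a\<^sup>2 * (hs_norm s ?h)\<^sup>2"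
    by blast
  define R where "R = 2 * ((exp (\<eta> * T))\<^sup>2 * (K + K\<^sup>2)) * (LINT \<zeta>|lborel. cmod (bump N \<zeta>) + (duhamel_weight \<zeta>)\<^sup>2)"
  have R: "R \<ge> 0" unfolding R_def using K by (intro mult_nonneg_nonneg integral_nonneg) auto
  \<comment> \<open>The first two entries keep \<gamma> below both thresholds; the third makes the
    cubic error at most half of the leading term.\<close>
  define \<gamma> where "\<gamma> = min (min (a0 / 2) (\<gamma>0 / 2)) (N / (8 * (R + 1)))"
  have \<gamma>: "0 < \<gamma>" "\<gamma> < a0" "\<gamma> < \<gamma>0" "\<gamma> \<le> 1" "\<gamma> \<le> N / (8 * (R + 1))"
    using a0 \<gamma>0 N R by (auto simp: \<gamma>_def)
  have "\<gamma> * R \<le> N / 8"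
  proof -
    have "\<gamma> * R \<le> \<gamma> * (R + 1)" using \<gamma> by simp
    also have "\<dots> \<le> N / (8 * (R + 1)) * (R + 1)" using \<gamma>(5) R by (intro mult_right_mono) auto
    also have "\<dots> = N / 8" using R by (simp add: field_simps)
    finally show ?thesis .
  qed
  then have "\<gamma>\<^sup>2 * (\<gamma> * R) \<le> \<gamma>\<^sup>2 * (N / 8)" by (intro mult_left_mono) auto
  then have R\<gamma>: "\<gamma>\<^sup>2 * N / 8 \<le> \<gamma>\<^sup>2 * N / 4 - \<gamma> ^ 3 * R"
    by (simp add: power2_eq_square power3_eq_cube mult_ac)
  have "5 * N\<^sup>2 * t * (\<gamma>\<^sup>2 * N / 8) / (16 * pi) \<le> window_functional N (\<Phi> (scaleX \<gamma> ?h) t)"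
  proof (rule mild_sol_window_lower_bound[OF pos N t sol])
    show "0 \<le> \<gamma>\<^sup>2 * N / 8" using N by simp
    fix t' \<xi> assume t': "t' \<in> {0..t}" and \<xi>: "\<xi> \<in> window N"
    have t'T: "t' \<in> {0..T}" using t' t by auto
    from window_convolution_lower_bound[OF pos N _ _ _ t(2) \<gamma>(1,4) K CHs_in_Hs[OF sol(1) t'T] \<xi> ae[OF \<gamma>(1,3) sol t'T], of T]
    show "\<gamma>\<^sup>2 * N / 8 \<le> Re (phase \<beta> \<eta> (t - t') \<xi> * (LINT \<zeta>|lborel. \<Phi> (scaleX \<gamma> ?h) t' (\<xi> - \<zeta>) * \<Phi> (scaleX \<gamma> ?h) t' \<zeta>))"
      using t' t R\<gamma> unfolding R_def by (simp add: mult_ac)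
  qed
  also have "\<dots> \<le> KN * C * \<gamma>\<^sup>2 * (hs_norm s ?h)\<^sup>2" using upper[OF \<gamma>(1,2)] by simp
  also have "\<dots> \<le> KN * C * \<gamma>\<^sup>2 * (2 * N * (N\<^sup>2) powr s)"
    using KN C by (intro mult_left_mono h) auto
  finally have "\<gamma>\<^sup>2 * (5 * N ^ 3 * t / (128 * pi)) \<le> \<gamma>\<^sup>2 * (KN * C * (2 * N * (N\<^sup>2) powr s))"
    by (simp add: power2_eq_square power3_eq_cube mult_ac)
  moreover have "\<gamma>\<^sup>2 > 0" using \<gamma>(1) by simp
  ultimately show ?thesis unfolding KN_def by (simp only: mult_le_cancel_left_pos)
qed

theorem theorem1p2:
  fixes \<beta> \<eta> s :: real
  assumes "\<beta> > 0" and "\<eta> > 0" and "s < - 1 / 2"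
  shows "\<not> (\<exists>T \<Phi>. T > 0 \<and> wp_C3_flow \<beta> \<eta> s T \<Phi>)"
proof
  assume "\<exists>T \<Phi>. T > 0 \<and> wp_C3_flow \<beta> \<eta> s T \<Phi>"
  then obtain T \<Phi> where T: "T > 0" and wp: "wp_C3_flow \<beta> \<eta> s T \<Phi>" by blast
  have s: "s \<le> 0" using assms(3) by simp
  have C3: "C3_near_zero s T \<Phi>" and CH: "\<And>\<phi>. \<phi> \<in> Hs s \<Longrightarrow> \<Phi> \<phi> \<in> CHs s T"
    using wp by (auto simp: wp_C3_flow_def)
  obtain C where C: "C \<ge> 0" and second: "quadratic_flow_bound s T \<Phi> C"
    using flow_second_order[OF C3 CH] by blast
  \<comment> \<open>With N \<ge> 1 the time \<tau> / N^2 stays in [0, T], and the second entry meets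
    the phase condition for every N at once.\<close>
  define \<tau> where "\<tau> = min T (1 / (36 * (\<beta> + \<eta>)))"
  have \<tau>: "\<tau> > 0" "\<tau> \<le> T" "36 * (\<beta> + \<eta>) * \<tau> \<le> 1"
  proof -
    show "\<tau> > 0" "\<tau> \<le> T" using T assms by (auto simp: \<tau>_def)
    have "36 * (\<beta> + \<eta>) * \<tau> \<le> 36 * (\<beta> + \<eta>) * (1 / (36 * (\<beta> + \<eta>)))"
      using assms by (intro mult_left_mono) (auto simp: \<tau>_def)
    then show "36 * (\<beta> + \<eta>) * \<tau> \<le> 1" using assms by simp
  qed
  define D where "D = sqrt (1 / 2) * sqrt (10 powr (- s)) * C * 2"
  have le: "5 * \<tau> / (128 * pi) \<le> D * N powr (1 / 2 + s)" if N: "N \<ge> 1" for N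
  proof -
    have "\<tau> / N\<^sup>2 \<le> \<tau> / 1" using N \<tau> by (intro divide_left_mono) auto
    then have t: "\<tau> / N\<^sup>2 \<in> {0..T}" using \<tau> by auto
    have "36 * (\<beta> + \<eta>) * N\<^sup>2 * (\<tau> / N\<^sup>2) \<le> 1" using \<tau>(3) N by simp
    from flow_inequality_at_scale[OF assms(1,2) s N t this wp C second]
    have "5 * N ^ 3 * (\<tau> / N\<^sup>2) / (128 * pi) \<le> sqrt (N / 2) * sqrt ((10 * N\<^sup>2) powr (- s)) * C * (2 * N * (N\<^sup>2) powr s)" .
    moreover have "5 * N ^ 3 * (\<tau> / N\<^sup>2) / (128 * pi) = N * (5 * \<tau> / (128 * pi))"
      using N by (simp add: power2_eq_square power3_eq_cube)
    moreover have "sqrt (N / 2) * sqrt ((10 * N\<^sup>2) powr (- s)) * C * (2 * N * (N\<^sup>2) powr s) = N * (D * N powr (1 / 2 + s))"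
    proof -
      have N2: "(N\<^sup>2) powr x = N powr (2 * x)" for x
      proof -
        have "(N\<^sup>2) powr x = (N powr 2) powr x" using N by simp
        also have "\<dots> = N powr (2 * x)" by (rule powr_powr)
        finally show ?thesis .
      qed
      have "sqrt ((10 * N\<^sup>2) powr (- s)) = sqrt (10 powr (- s)) * sqrt (N powr (- (2 * s)))"
        using N by (simp add: powr_mult N2 real_sqrt_mult)
      also have "sqrt (N powr (- (2 * s))) = N powr (- s)"
        using N by (simp add: powr_half_sqrt[symmetric] powr_powr)
      finally have 1: "sqrt ((10 * N\<^sup>2) powr (- s)) = sqrt (10 powr (- s)) * N powr (- s)" .
      have 2: "sqrt (N / 2) = sqrt (1 / 2) * N powr (1 / 2)"
        using N by (simp add: powr_half_sqrt real_sqrt_divide)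
      have 3: "(N\<^sup>2) powr s = N powr (2 * s)" by (rule N2)
      have "N powr (1 / 2) * N powr (- s) * N powr (2 * s) = N powr (1 / 2 + s)"
        by (simp add: powr_add[symmetric] add.commute)
      then show ?thesis unfolding 1 2 3 D_def by (simp add: mult_ac)
    qed
    ultimately have "N * (5 * \<tau> / (128 * pi)) \<le> N * (D * N powr (1 / 2 + s))" by simp
    then show ?thesis using N by (simp only: mult_le_cancel_left_pos)
  qed
  \<comment> \<open>Here s < -1/2 enters: the exponent is negative, so the upper bound drops below a
    fixed positive number.\<close>
  have "((\<lambda>N. D * N powr (1 / 2 + s)) \<longlongrightarrow> D * 0) at_top"
    using assms(3) by (intro tendsto_mult_left tendsto_neg_powr filterlim_ident) simp
  then have "\<forall>\<^sub>F N in at_top. D * N powr (1 / 2 + s) < 5 * \<tau> / (128 * pi)"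
    using \<tau>(1) by (intro order_tendstoD(2)) auto
  moreover have "\<forall>\<^sub>F N in at_top. (1::real) \<le> N" by (rule eventually_ge_at_top)
  ultimately have "\<forall>\<^sub>F N in at_top. D * N powr (1 / 2 + s) < 5 * \<tau> / (128 * pi) \<and> 1 \<le> N"
    by (rule eventually_conj)
  then obtain N where "D * N powr (1 / 2 + s) < 5 * \<tau> / (128 * pi)" "1 \<le> N"
    using eventually_happens'[OF trivial_limit_at_top_linorder] by blast
  with le[of N] show False by simp
qed

end
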